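(* For every real $p$ with $1<p<\infty$, $$C_p\ \geq\ \begin{cases} c_p & \text{if } 1<p\leq 2,\\ c_p^{\ast} & \text{if } 2\leq p<\infty.\end{cases}$$ In other words, if $p>1$ and $\epsilon>0$ are given, then for each measurable set $E\subset\mathbb{T}$ with $|E|>0$ there is a finite non-empty set of integers $S=S(E,p,\epsilon)$ such that $$\frac{\int_{E}\left|\sum_{n\in S}e(nx)\right|^{p}dx}{\int_{\mathbb{T}}\left|\sum_{n\in S}e(nx)\right|^{p}dx}\ \geq\ \begin{cases} (c_p)^{p}-\epsilon & \text{if } 1<p\leq 2,\\ (c_p^{\ast})^{p}-\epsilon & \text{if } 2\leq p<\infty.\end{cases}$$ Furthermore, $c_p^{\ast}\to 1$ as $p\to\infty$, and a fortiori $C_p\to 1$ as $p\to\infty$.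
   Context: Notation: $\mathbb{T}=\mathbb{R}/\mathbb{Z}$ with Lebesgue measure $|\cdot|$ (total mass $1$), and $e(x):=\exp(2\pi i x)$. Let $$\wp:=\Big\{\sum_{n\in S}e(nx): S\text{ is a finite (non-empty) set of non-negative integers}\Big\}$$ be the set of idempotent trigonometric polynomials. For $1\le p<\infty$, $C_p$ is the largest real number such that for every measurable set $E\subset\mathbb{T}$ with $|E|>0$, $$\sup_{f\in\wp}\left(\frac{\int_{E}|f(x)|^{p}dx}{\int_{\mathbb{T}}|f(x)|^{p}dx}\right)^{1/p}\geq C_p ;$$ that is, $C_p$ is the infimum of the left-hand side over all such $E$. For $p>1$ define $$c_p:=\sup_{0<\omega<1/2}\ \frac{\sin(\pi\omega)/(\pi\omega)}{2^{1+1/p}\left(\lfloor 1/\omega\rfloor+1+\frac{1}{p-1}\left(\frac{3}{8}\right)^{p}\lfloor 1/\omega\rfloor\right)^{1/p}},$$ where $\lfloor r\rfloor$ denotes the greatest integer less than or equal to $r$, and $$c_p^{\ast}:=\left(\frac{2}{\pi^{p+1}}\int_{0}^{\infty}\left|\frac{\sin x}{x}\right|^{p}dx\right)^{1/p}\cdot\max_{0\leq\omega\leq 1}\frac{\sin(\pi\omega)}{\omega^{1-1/p}},$$ where the quotient $\sin(\pi\omega)/\omega^{1-1/p}$ is given its limiting value $0$ at $\omega=0$. *)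

theory Defs
  imports "HOL-Analysis.Analysis"
begin

text \<open>
  The circle group of reals modulo 1, with normalised Lebesgue measure, is represented by its
  fundamental domain \<open>{0..<1}\<close> with Lebesgue measure on the line; measurable means Lebesgue
  measurable.
\<close>

definition circle :: "real set" where
  "circle = {0..<1}"

definition unit_exp :: "real \<Rightarrow> complex" where
  "unit_exp x = exp (2 * of_real pi * \<i> * of_real x)"

definition idempotent_polys :: "(real \<Rightarrow> complex) set" where
  "idempotent_polys =
     {f. \<exists>S :: nat set. finite S \<and> S \<noteq> {} \<and> f = (\<lambda>x. \<Sum>n\<in>S. unit_exp (real n * x))}"

definition Lp_ratio :: "real \<Rightarrow> real set \<Rightarrow> (real \<Rightarrow> complex) \<Rightarrow> real" where
  "Lp_ratio p E f =
     (LINT x:E|lebesgue. norm (f x) powr p) / (LINT x:circle|lebesgue. norm (f x) powr p)"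

text \<open>
  For \<open>E \<subseteq> circle\<close> and an idempotent polynomial \<open>f\<close> the ratio lies in \<open>{0..1}\<close>, so the real-valued
  supremum and infimum below are over bounded non-empty sets.
\<close>

definition conc_const :: "real \<Rightarrow> real" where
  "conc_const p =
     (INF E \<in> {E \<in> sets lebesgue. E \<subseteq> circle \<and> measure lebesgue E > 0}.
        SUP f \<in> idempotent_polys. Lp_ratio p E f powr (1 / p))"

definition c_lower :: "real \<Rightarrow> real" where
  "c_lower p =
     (SUP \<omega> \<in> {0<..<1/2}.
        (sin (pi * \<omega>) / (pi * \<omega>)) /
        (2 powr (1 + 1 / p) *
         (of_int \<lfloor>1 / \<omega>\<rfloor> + 1 + 1 / (p - 1) * (3 / 8) powr p * of_int \<lfloor>1 / \<omega>\<rfloor>) powr (1 / p)))"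

text \<open>
  The quotient inside the supremum extends continuously by 0 at \<open>\<omega> = 0\<close> (and is literally
  0 there, since \<open>0 / 0 = 0\<close>), so the supremum over the compact interval is a maximum.
\<close>

definition c_star :: "real \<Rightarrow> real" where
  "c_star p =
     (2 / pi powr (p + 1) * (LINT x:{0<..}|lebesgue. \<bar>sin x / x\<bar> powr p)) powr (1 / p) *
     (SUP \<omega> \<in> {0..1}. sin (pi * \<omega>) / \<omega> powr (1 - 1 / p))"

end

theory Submission
  imports Defs "HOL-Probability.Sinc_Integral"
begin

text \<open>
  Let \<open>D\<^sub>m(x)\<close> denote the sum of \<open>e(j x)\<close> over \<open>0 \<le> j < m\<close>. Given \<open>E\<close>, choose a reduced fraction \<open>k / q\<close>
  with large \<open>q\<close> such that \<open>E\<close> has almost full measure in the interval of radius \<open>1 / q\<^sup>2\<close> about \<open>k / q\<close>;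
  density points and Dirichlet's approximation theorem provide it (\<open>rational_density_point\<close>). Choose \<open>l\<close> with
  \<open>l k \<equiv> 1\<close> modulo \<open>q\<close>, fix \<open>0 < \<omega> < 1\<close>, let \<open>m\<close> be about \<open>\<omega> q\<close>, and put
  \<open>f(x) = D\<^sub>m(l x) D\<^sub>n(q x)\<close> with \<open>n\<close> a large multiple of \<open>q\<close>. For \<open>m \<le> q\<close> this is an idempotent polynomial
  (\<open>dirichlet_product_idempotent\<close>).

  As \<open>p > 1\<close>, the factor \<open>D\<^sub>n(q x)\<close> carries its norm on neighbourhoods of the points \<open>j / q\<close> much shorter than
  \<open>1 / q\<^sup>2\<close>, equally at each of them. The factor \<open>D\<^sub>m(l x)\<close> weights these peaks: it has modulus
  \<open>\<bar>D\<^sub>m(1 / q)\<bar>\<close>, about \<open>q sin (\<pi> \<omega>) / \<pi>\<close>, near \<open>k / q\<close>, while averaging over translations shows that the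
  full norm involves only the moments \<open>\<Sum>\<^sub>j \<bar>D\<^sub>m(j / q + s)\<bar>\<^sup>p\<close> over \<open>j < q\<close>
  (\<open>integral_modulated_dirichlet_le\<close>). If these are at most \<open>q\<^sup>p H(m / q)\<close> for all \<open>s \<ge> 0\<close>, the ratio of
  integrals gets as close as desired to \<open>(sin (\<pi> \<omega>) / \<pi>)\<^sup>p / H(\<omega>)\<close>, or exceeds it
  (\<open>concentration_near_rational\<close>, \<open>concentration_limit\<close>).

  For \<open>p \<ge> 2\<close> the trivial bound \<open>\<bar>D\<^sub>m\<bar> \<le> m\<close> and Parseval on the cyclic group of order \<open>q\<close> give
  \<open>H(\<omega>) = \<omega>\<^sup>p\<^sup>-\<^sup>1\<close>. The resulting level \<open>sin (\<pi> \<omega>) / (\<pi> \<omega>\<^sup>1\<^sup>-\<^sup>1\<^sup>/\<^sup>p)\<close> dominates the one in \<open>c_star\<close>, because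
  the integral of \<open>\<bar>sin x / x\<bar>\<^sup>p\<close> over the positive axis is at most \<open>\<pi> / 2\<close>. For \<open>1 < p \<le> 2\<close> the bound of \<open>\<bar>D\<^sub>m\<bar>\<close>
  by \<open>m\<close> and by the inverse of twice the distance to the integers gives
  \<open>H(\<omega>) = \<omega>\<^sup>p (1 / \<omega> + 4 + 1 / (\<omega> (p - 1)))\<close>, and an elementary comparison yields \<open>c_lower\<close>.

  That \<open>c_star\<close> tends to 1 is seen by restricting its integral to \<open>(0, a]\<close> and evaluating its supremum at
  \<open>\<omega> = a / \<pi>\<close> for small \<open>a\<close>; the concentration constant lies between \<open>c_star\<close> and 1.
\<close>

section \<open>Characters and Dirichlet kernels\<close>

lemma unit_exp_add: "unit_exp (x + y) = unit_exp x * unit_exp y"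
  by (simp add: unit_exp_def exp_add[symmetric] algebra_simps)

lemma unit_exp_of_nat_mult: "unit_exp (real n * x) = unit_exp x ^ n"
  by (simp add: unit_exp_def exp_of_nat_mult[symmetric] algebra_simps)

lemma norm_unit_exp [simp]: "norm (unit_exp x) = 1"
  using norm_exp_i_times[of "2 * pi * x"] by (simp add: unit_exp_def algebra_simps)

lemma unit_exp_minus: "unit_exp (- x) = cnj (unit_exp x)"
  by (simp add: unit_exp_def exp_cnj)

lemma unit_exp_of_int [simp]: "unit_exp (of_int k) = 1"
  using exp_integer_2pi[of "of_int k"] by (simp add: unit_exp_def algebra_simps)

lemma unit_exp_0 [simp]: "unit_exp 0 = 1"
  by (simp add: unit_exp_def)

lemma norm_unit_exp_diff_1: "norm (unit_exp x - 1) = 2 * \<bar>sin (pi * x)\<bar>"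
  using dist_exp_i_1[of "2 * pi * x"] by (simp add: unit_exp_def algebra_simps)

lemma norm_unit_exp_diff: "norm (unit_exp x - unit_exp y) \<le> 2 * pi * \<bar>x - y\<bar>"
proof -
  have "unit_exp x - unit_exp y = unit_exp y * (unit_exp (x - y) - 1)"
    using unit_exp_add[of y "x - y"] by (simp add: algebra_simps)
  then have "norm (unit_exp x - unit_exp y) = 2 * \<bar>sin (pi * (x - y))\<bar>"
    by (simp add: norm_mult norm_unit_exp_diff_1)
  also have "\<dots> \<le> 2 * \<bar>pi * (x - y)\<bar>"
    using abs_sin_x_le_abs_x[of "pi * (x - y)"] by simp
  finally show ?thesis by (simp add: abs_mult)
qed

lemma continuous_on_unit_exp [continuous_intros]:
  "continuous_on A f \<Longrightarrow> continuous_on A (\<lambda>x. unit_exp (f x))"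
  unfolding unit_exp_def by (intro continuous_intros)

text \<open>
  The Dirichlet kernel \<open>D\<^sub>m(x) = 1 + e(x) + \<dots> + e((m - 1) x)\<close>: the analytic (one-sided) version, itself an
  idempotent polynomial, with the sum over \<open>m\<close> frequencies starting at 0.
\<close>

definition dirichlet :: "nat \<Rightarrow> real \<Rightarrow> complex" where
  "dirichlet m x = (\<Sum>j<m. unit_exp (real j * x))"

lemma continuous_on_dirichlet [continuous_intros]:
  "continuous_on A f \<Longrightarrow> continuous_on A (\<lambda>x. dirichlet m (f x))"
  unfolding dirichlet_def by (intro continuous_intros)

lemma norm_dirichlet_le: "norm (dirichlet m x) \<le> m"
  unfolding dirichlet_def using sum_norm_le[of "{..<m}" "\<lambda>j. unit_exp (real j * x)" "\<lambda>_. 1"] by simp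

lemma dirichlet_0 [simp]: "dirichlet m 0 = of_nat m"
  by (simp add: dirichlet_def)

lemma dirichlet_add_int [simp]: "dirichlet m (x + of_int k) = dirichlet m x"
proof -
  have "unit_exp (real j * (x + of_int k)) = unit_exp (real j * x)" for j
    using unit_exp_of_int[of "int j * k"]
    by (simp add: ring_distribs unit_exp_add del: unit_exp_of_int)
  then show ?thesis by (simp add: dirichlet_def)
qed

lemma dirichlet_add_nat [simp]: "dirichlet m (x + of_nat k) = dirichlet m x"
  using dirichlet_add_int[of m x "int k"] by simp

lemma norm_dirichlet_minus [simp]: "norm (dirichlet m (- x)) = norm (dirichlet m x)"
proof -
  have "dirichlet m (- x) = cnj (dirichlet m x)"
    by (simp add: dirichlet_def unit_exp_minus[symmetric])
  then show ?thesis by simp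
qed

lemma norm_dirichlet_times_sin: "norm (dirichlet m x) * \<bar>sin (pi * x)\<bar> = \<bar>sin (pi * (real m * x))\<bar>"
proof -
  have "dirichlet m x * (unit_exp x - 1) = unit_exp (real m * x) - 1"
    using power_diff_1_eq[of "unit_exp x" m]
    unfolding dirichlet_def unit_exp_of_nat_mult by (simp add: mult.commute)
  then have "norm (dirichlet m x) * norm (unit_exp x - 1) = norm (unit_exp (real m * x) - 1)"
    by (metis norm_mult)
  then show ?thesis by (simp add: norm_unit_exp_diff_1)
qed

lemma dirichlet_lipschitz: "norm (dirichlet m x - dirichlet m y) \<le> 2 * pi * real m ^ 2 * \<bar>x - y\<bar>"
proof -
  have "norm (dirichlet m x - dirichlet m y)
      \<le> (\<Sum>j<m. norm (unit_exp (real j * x) - unit_exp (real j * y)))"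
    unfolding dirichlet_def sum_subtractf[symmetric] by (rule norm_sum)
  also have "\<dots> \<le> (\<Sum>j<m. 2 * pi * (real m * \<bar>x - y\<bar>))"
  proof (rule sum_mono)
    fix j assume "j \<in> {..<m}"
    have "norm (unit_exp (real j * x) - unit_exp (real j * y)) \<le> 2 * pi * (real j * \<bar>x - y\<bar>)"
      using norm_unit_exp_diff[of "real j * x" "real j * y"]
      by (simp add: right_diff_distrib[symmetric] abs_mult)
    also have "\<dots> \<le> 2 * pi * (real m * \<bar>x - y\<bar>)"
      using \<open>j \<in> {..<m}\<close> by (intro mult_left_mono mult_right_mono) auto
    finally show "norm (unit_exp (real j * x) - unit_exp (real j * y)) \<le> 2 * pi * (real m * \<bar>x - y\<bar>)" .
  qed
  finally show ?thesis by (simp add: power2_eq_square algebra_simps)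
qed

text \<open>Jordan's inequality, from the concavity of the sine.\<close>

lemma sin_pi_ge:
  assumes "0 \<le> x" "x \<le> 1 / 2"
  shows "2 * x \<le> sin (pi * x)"
proof -
  have c: "concave_on {0..pi} sin"
    by (rule f''_le0_imp_concave[where f' = cos and f'' = "\<lambda>x. - sin x"])
      (auto intro!: derivative_eq_intros sin_ge_zero)
  have "(1 - 2 * x) * sin 0 + (2 * x) * sin (pi / 2) \<le> sin ((1 - 2 * x) *\<^sub>R 0 + (2 * x) *\<^sub>R (pi / 2))"
    by (rule concave_onD[OF c]) (use assms in auto)
  then show ?thesis by (simp add: mult.commute)
qed

lemma norm_dirichlet_le_inverse:
  assumes "0 < x" "x \<le> 1 / 2"
  shows "norm (dirichlet m x) \<le> 1 / (2 * x)"
proof -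
  have s: "2 * x \<le> \<bar>sin (pi * x)\<bar>"
    using sin_pi_ge[of x] assms by simp
  have "norm (dirichlet m x) * (2 * x) \<le> norm (dirichlet m x) * \<bar>sin (pi * x)\<bar>"
    using s by (intro mult_left_mono) auto
  also have "\<dots> \<le> 1"
    by (simp add: norm_dirichlet_times_sin)
  finally show ?thesis
    using assms by (simp add: field_simps)
qed

lemma norm_dirichlet_le_inverse':
  assumes "1 / 2 \<le> x" "x < 1"
  shows "norm (dirichlet m x) \<le> 1 / (2 * (1 - x))"
proof -
  have "norm (dirichlet m x) = norm (dirichlet m (- (1 - x)))"
    using dirichlet_add_int[of m x "-1"] by simp
  also have "\<dots> = norm (dirichlet m (1 - x))"
    by (rule norm_dirichlet_minus)
  also have "\<dots> \<le> 1 / (2 * (1 - x))"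
    using assms by (intro norm_dirichlet_le_inverse) auto
  finally show ?thesis .
qed

text \<open>
  At \<open>1 / q\<close> the kernel is comparable to its maximum \<open>m\<close>: writing \<open>\<omega> = m / q\<close>, the modulus is
  \<open>sin (\<pi> \<omega>) / sin (\<pi> / q)\<close>. This is the peak on which the concentration rests.
\<close>

lemma norm_dirichlet_inverse_ge:
  assumes "0 < m" "m \<le> q"
  shows "norm (dirichlet m (1 / real q)) \<ge> real q * (sin (pi * (real m / real q)) / pi)"
proof (cases "q = 1")
  case True
  then show ?thesis using assms by simp
next
  case False
  then have q: "q \<ge> 2" using assms by simp
  have "0 < sin (pi * (1 / real q))"
    using q by (intro sin_gt_zero) (auto simp: field_simps)
  moreover have "sin (pi * (1 / real q)) \<le> pi * (1 / real q)"
    using q by (intro sin_x_le_x) auto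
  ultimately have s: "\<bar>sin (pi * (1 / real q))\<bar> \<le> pi / real q" by simp
  have "sin (pi * (real m / real q)) \<le> norm (dirichlet m (1 / real q)) * \<bar>sin (pi * (1 / real q))\<bar>"
    unfolding norm_dirichlet_times_sin by simp
  also have "\<dots> \<le> norm (dirichlet m (1 / real q)) * (pi / real q)"
    using s by (intro mult_left_mono) auto
  finally show ?thesis
    using q by (simp add: field_simps)
qed

lemma sum_unit_exp_roots:
  fixes d :: int
  assumes "\<not> int q dvd d"
  shows "(\<Sum>j<q. unit_exp (of_int d * (real j / real q))) = 0"
proof (cases "q = 0")
  case q: False
  define z where "z = unit_exp (of_int d / real q)"
  have "z ^ q = unit_exp (real q * (of_int d / real q))"
    unfolding z_def by (rule unit_exp_of_nat_mult[symmetric])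
  then have zq: "z ^ q = 1" using q by simp
  have z1: "z \<noteq> 1"
  proof
    assume "z = 1"
    then have "sin (pi * (of_int d / real q)) = 0"
      using norm_unit_exp_diff_1[of "of_int d / real q"] by (simp add: z_def)
    then obtain i :: int where "pi * (of_int d / real q) = of_int i * pi"
      using sin_zero_iff_int2 by blast
    then have "of_int d = (of_int (i * int q) :: real)"
      using q by (simp add: field_simps)
    then have "d = i * int q" by linarith
    then show False using assms by simp
  qed
  have "(\<Sum>j<q. unit_exp (of_int d * (real j / real q))) = (\<Sum>j<q. z ^ j)"
    unfolding z_def unit_exp_of_nat_mult[symmetric] by (simp add: field_simps)
  also have "\<dots> = 0"
    using power_diff_1_eq[of z q] zq z1 by simp
  finally show ?thesis .
qed simp

text \<open>
  Parseval on the cyclic group of order \<open>q\<close>: for \<open>m \<le> q\<close> the frequencies \<open>0, \<dots>, m - 1\<close> are distinct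
  modulo \<open>q\<close>, so they stay orthogonal when sampled at a translate of the \<open>q\<close>-th roots of unity.
\<close>

lemma sum_norm_dirichlet_power2:
  assumes "m \<le> q"
  shows "(\<Sum>j<q. norm (dirichlet m (real j / real q + s)) ^ 2) = real q * real m"
proof -
  define e where "e a = unit_exp (real a * s)" for a :: nat
  have *: "complex_of_real (norm (dirichlet m (real j / real q + s)) ^ 2)
     = (\<Sum>a<m. \<Sum>b<m. e a * cnj (e b) * unit_exp (of_int (int a - int b) * (real j / real q)))" for j
  proof -
    have "unit_exp (real a * (real j / real q + s)) = e a * unit_exp (real a * (real j / real q))" for a
      unfolding e_def by (simp add: unit_exp_add[symmetric] algebra_simps)
    then have "complex_of_real (norm (dirichlet m (real j / real q + s)) ^ 2)
        = (\<Sum>a<m. \<Sum>b<m. e a * cnj (e b) *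
            (unit_exp (real a * (real j / real q)) * cnj (unit_exp (real b * (real j / real q)))))"
      unfolding complex_norm_square dirichlet_def by (simp add: sum_product algebra_simps)
    also have "\<dots> = (\<Sum>a<m. \<Sum>b<m. e a * cnj (e b) * unit_exp (of_int (int a - int b) * (real j / real q)))"
      unfolding unit_exp_minus[symmetric] unit_exp_add[symmetric]
      by (simp add: left_diff_distrib diff_divide_distrib)
    finally show ?thesis .
  qed
  have "complex_of_real (\<Sum>j<q. norm (dirichlet m (real j / real q + s)) ^ 2)
      = (\<Sum>j<q. complex_of_real (norm (dirichlet m (real j / real q + s)) ^ 2))" by simp
  also have "\<dots> = (\<Sum>j<q. \<Sum>a<m. \<Sum>b<m. e a * cnj (e b) * unit_exp (of_int (int a - int b) * (real j / real q)))"
    by (simp only: *)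
  also have "\<dots> = (\<Sum>a<m. \<Sum>b<m. e a * cnj (e b) * (\<Sum>j<q. unit_exp (of_int (int a - int b) * (real j / real q))))"
    unfolding sum_distrib_left
    by (subst sum.swap, rule sum.cong[OF refl], rule sum.swap)
  also have "\<dots> = (\<Sum>a<m. \<Sum>b<m. if a = b then of_nat q else 0)"
  proof (intro sum.cong refl)
    fix a b assume ab: "a \<in> {..<m}" "b \<in> {..<m}"
    show "e a * cnj (e b) * (\<Sum>j<q. unit_exp (of_int (int a - int b) * (real j / real q)))
       = (if a = b then of_nat q else 0)"
    proof (cases "a = b")
      case True
      have "e b * cnj (e b) = 1"
        using complex_norm_square[of "e b"] by (simp add: e_def)
      then show ?thesis using True by simp
    next
      case False
      have "\<not> int q dvd int a - int b"
        using ab assms False zdvd_not_zless[of "\<bar>int a - int b\<bar>" "int q"] by auto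
      then show ?thesis unfolding sum_unit_exp_roots[OF \<open>\<not> int q dvd int a - int b\<close>] using False by simp
    qed
  qed
  also have "\<dots> = of_nat (m * q)" by simp
  finally have "complex_of_real (\<Sum>j<q. norm (dirichlet m (real j / real q + s)) ^ 2) = of_real (real q * real m)"
    by simp
  then show ?thesis by (simp only: of_real_eq_iff)
qed

section \<open>Moments of the Dirichlet kernel over cosets of the roots of unity\<close>

text \<open>
  For \<open>p \<ge> 2\<close> the moment is controlled by pulling out \<open>\<bar>D\<^sub>m\<bar>\<^sup>p\<^sup>-\<^sup>2 \<le> m\<^sup>p\<^sup>-\<^sup>2\<close> and applying Parseval.
\<close>

lemma sum_dirichlet_powr_ge_2:
  assumes "2 \<le> p" "0 < m" "m \<le> q"
  shows "(\<Sum>j<q. norm (dirichlet m (real j / real q + s)) powr p) \<le> real q * real m powr (p - 1)"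
proof -
  have "(\<Sum>j<q. norm (dirichlet m (real j / real q + s)) powr p)
      \<le> (\<Sum>j<q. real m powr (p - 2) * norm (dirichlet m (real j / real q + s)) ^ 2)"
  proof (rule sum_mono)
    fix j
    let ?d = "norm (dirichlet m (real j / real q + s))"
    have "?d powr p = ?d powr (p - 2) * ?d ^ 2"
      using powr_add[of ?d "p - 2" 2] by (cases "?d = 0") simp_all
    also have "\<dots> \<le> real m powr (p - 2) * ?d ^ 2"
      using assms by (intro mult_right_mono powr_mono2 norm_dirichlet_le) auto
    finally show "?d powr p \<le> real m powr (p - 2) * ?d ^ 2" .
  qed
  also have "\<dots> = real m powr (p - 2) * (real q * real m)"
    using assms by (simp add: sum_distrib_left[symmetric] sum_norm_dirichlet_power2)
  also have "\<dots> = real q * real m powr (p - 1)"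
    using assms powr_add[of "real m" "p - 2" 1] by simp
  finally show ?thesis .
qed

text \<open>
  The mean value theorem bounds a term of the series \<open>\<Sum> j\<^sup>-\<^sup>p\<close> by a telescoping difference.
\<close>

lemma powr_minus_le_telescope:
  fixes p x :: real
  assumes "1 < p" "1 < x"
  shows "x powr (- p) \<le> ((x - 1) powr (1 - p) - x powr (1 - p)) / (p - 1)"
proof -
  have "\<exists>z. x - 1 < z \<and> z < x \<and> x powr (1 - p) - (x - 1) powr (1 - p) = (x - (x - 1)) * ((1 - p) * z powr (- p))"
  proof (rule MVT2)
    fix z assume "x - 1 \<le> z" "z \<le> x"
    then show "((\<lambda>z. z powr (1 - p)) has_real_derivative (1 - p) * z powr (- p)) (at z)"
      using has_real_derivative_powr[of z "1 - p"] assms by simp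
  qed simp
  then obtain z where z: "x - 1 < z" "z < x"
    "x powr (1 - p) - (x - 1) powr (1 - p) = (1 - p) * z powr (- p)" by auto
  have "x powr (- p) \<le> z powr (- p)"
    using z assms by (intro powr_mono2') auto
  also have "z powr (- p) = ((x - 1) powr (1 - p) - x powr (1 - p)) / (p - 1)"
    using z(3) assms by (simp add: field_simps)
  finally show ?thesis .
qed

lemma sum_min_powr_le:
  fixes A p :: real
  assumes "1 < p" "0 < A"
  shows "(\<Sum>j<n. (if real j \<le> A then 1 else A / real j) powr p) \<le> A + 2 + A / (p - 1)"
proof -
  let ?g = "\<lambda>j::nat. (if real j \<le> A then 1 else A / real j) powr p"
  \<comment> \<open>\<open>J - 1\<close> is the first integer beyond \<open>A\<close>: the terms below \<open>J\<close> are bounded by 1, the others telescope.\<close>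
  define J where "J = nat \<lfloor>A\<rfloor> + 2"
  have J: "real J \<le> A + 2" "A \<le> real J - 1" "2 \<le> J"
    using assms unfolding J_def by linarith+
  have g1: "?g j \<le> 1" for j
    using assms by (auto intro!: powr_le1)
  have tail: "(\<Sum>j\<in>{J..<n}. ?g j) \<le> A / (p - 1)"
  proof (cases "J \<le> n")
    case True
    define T where "T j = - ((real j - 1) powr (1 - p))" for j
    have "(\<Sum>j\<in>{J..<n}. ?g j) \<le> (\<Sum>j\<in>{J..<n}. A powr p * (T (Suc j) - T j) / (p - 1))"
    proof (rule sum_mono)
      fix j assume "j \<in> {J..<n}"
      then have j: "A < real j" "1 < real j" using J by auto
      have "?g j = A powr p * real j powr (- p)"
        using j assms by (simp add: powr_divide powr_minus_divide)
      also have "\<dots> \<le> A powr p * (((real j - 1) powr (1 - p) - real j powr (1 - p)) / (p - 1))"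
        using j assms by (intro mult_left_mono powr_minus_le_telescope) auto
      finally show "?g j \<le> A powr p * (T (Suc j) - T j) / (p - 1)"
        by (simp add: T_def)
    qed
    also have "\<dots> = A powr p * (T n - T J) / (p - 1)"
      unfolding sum_divide_distrib[symmetric] sum_distrib_left[symmetric]
      using sum_Suc_diff'[OF True, of T] by simp
    also have "\<dots> \<le> A powr p * (A powr (1 - p)) / (p - 1)"
    proof -
      have "(real J - 1) powr (1 - p) \<le> A powr (1 - p)"
        using assms J by (intro powr_mono2') auto
      moreover have "0 \<le> (real n - 1) powr (1 - p)" by simp
      ultimately have "T n - T J \<le> A powr (1 - p)"
        unfolding T_def by linarith
      then show ?thesis
        using assms by (intro divide_right_mono mult_left_mono) auto
    qed
    also have "\<dots> = A / (p - 1)"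
      using assms by (simp add: powr_add[symmetric])
    finally show ?thesis .
  qed (use assms in auto)
  have "(\<Sum>j<n. ?g j) \<le> (\<Sum>j\<in>{..<J} \<union> {J..<n}. ?g j)"
    by (intro sum_mono2) auto
  also have "\<dots> = (\<Sum>j<J. ?g j) + (\<Sum>j\<in>{J..<n}. ?g j)"
    by (intro sum.union_disjoint) auto
  also have "\<dots> \<le> real J + A / (p - 1)"
    using tail sum_bounded_above[of "{..<J}" ?g 1] g1 by simp
  finally show ?thesis using J by simp
qed

lemma sum_lessThan_shift_periodic:
  fixes g :: "nat \<Rightarrow> real"
  assumes "\<And>j. g (j + q) = g j"
  shows "(\<Sum>j<q. g (j + a)) = (\<Sum>j<q. g j)"
proof (induction a)
  case (Suc a)
  have "(\<Sum>j<q. g (j + Suc a)) + g (0 + a) = (\<Sum>j<Suc q. g (j + a))"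
    by (simp only: sum.lessThan_Suc_shift) (simp add: add.commute)
  also have "\<dots> = (\<Sum>j<q. g (j + a)) + g (0 + a)"
    using assms[of a] by (simp add: add.commute)
  finally show ?case using Suc by simp
qed simp

text \<open>
  For \<open>1 < p < 2\<close> Parseval is of no use, but \<open>\<bar>D\<^sub>m\<bar>\<close> is at most both \<open>m\<close> and the inverse of twice the distance
  to the nearest integer. The sample points are \<open>1 / q\<close> apart, so on each side of 0 they are summed by
  \<open>sum_min_powr_le\<close> with threshold \<open>A = q / (2 m)\<close>, where the two bounds meet.
\<close>

lemma sum_dirichlet_powr_gt_1:
  assumes "1 < p" "0 < m" "m \<le> q" "0 \<le> s"
  shows "(\<Sum>j<q. norm (dirichlet m (real j / real q + s)) powr p)
    \<le> real m powr p * (real q / real m + 4 + real q / real m / (p - 1))"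
proof -
  have q: "0 < q" using assms by simp
  \<comment> \<open>Shifting \<open>j\<close> by \<open>a\<close> reduces to sample points \<open>(j + t) / q\<close> in \<open>[0, 1)\<close>.\<close>
  define a where "a = nat \<lfloor>real q * s\<rfloor>"
  define t where "t = frac (real q * s)"
  have t: "0 \<le> t" "t < 1" by (auto simp: t_def frac_lt_1)
  have "0 \<le> real q * s" using assms by simp
  then have "real q * s = real a + t" by (simp add: a_def t_def frac_def)
  then have s: "s = real a / real q + t / real q"
    using q by (simp add: field_simps)
  define A where "A = real q / (2 * real m)"
  have A: "0 < A" using assms q by (simp add: A_def)
  let ?b = "\<lambda>j::nat. (if real j \<le> A then 1 else A / real j) powr p"
  define g where "g j = norm (dirichlet m ((real j + t) / real q)) powr p" for j :: nat
  have near: "norm (dirichlet m x) powr p \<le> real m powr p * ?b i"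
    if "norm (dirichlet m x) \<le> 1 / (2 * y) \<or> i = 0" "real i / real q \<le> y" "0 \<le> y" for x y i
  proof (cases "real i \<le> A")
    case True
    then show ?thesis using assms by (auto intro!: powr_mono2 norm_dirichlet_le)
  next
    case False
    then have i: "0 < real i" using A by linarith
    have y: "1 / (2 * y) \<le> 1 / (2 * (real i / real q))"
    proof (rule frac_le)
      show "0 < 2 * (real i / real q)" using i q by simp
      show "2 * (real i / real q) \<le> 2 * y" using that by simp
    qed simp_all
    have "norm (dirichlet m x) \<le> 1 / (2 * (real i / real q))"
      using y that i by auto
    also have "\<dots> = real m * (A / real i)"
      using i q assms by (simp add: A_def field_simps)
    finally have "norm (dirichlet m x) \<le> real m * (A / real i)" .
    then have "norm (dirichlet m x) powr p \<le> (real m * (A / real i)) powr p"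
      using assms by (intro powr_mono2) auto
    also have "\<dots> = real m powr p * (A / real i) powr p"
      by (rule powr_mult)
    finally show ?thesis
      using False by simp
  qed
  have gb: "g j \<le> real m powr p * ?b j + real m powr p * ?b (q - Suc j)" if j: "j < q" for j
  proof -
    define x where "x = (real j + t) / real q"
    have x: "real j / real q \<le> x" "x < 1" "0 \<le> x"
      using t j q by (auto simp: x_def field_simps)
    have x': "real (q - Suc j) / real q \<le> 1 - x"
      using t j q by (simp add: x_def field_simps of_nat_diff)
    have nonneg: "0 \<le> real m powr p * ?b i" for i by simp
    consider "x = 0" | "0 < x" "x \<le> 1 / 2" | "1 / 2 \<le> x" using x by linarith
    then have "norm (dirichlet m x) powr p \<le> real m powr p * ?b j \<or>
        norm (dirichlet m x) powr p \<le> real m powr p * ?b (q - Suc j)"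
    proof cases
      case 1
      then have "j = 0" using x q by (simp add: field_simps)
      then show ?thesis using near[of x 0 j] 1 by (intro disjI1) simp
    next
      case 2
      then show ?thesis using near[of x x j] x norm_dirichlet_le_inverse[of x m] by auto
    next
      case 3
      then show ?thesis using near[of x "1 - x" "q - Suc j"] x x' norm_dirichlet_le_inverse'[of x m] by auto
    qed
    then show ?thesis
      unfolding g_def x_def[symmetric] using nonneg[of j] nonneg[of "q - Suc j"] by linarith
  qed
  have per: "g (j + q) = g j" for j
  proof -
    have "(real (j + q) + t) / real q = (real j + t) / real q + real 1"
      using q by (simp add: field_simps)
    then show ?thesis unfolding g_def by (simp only: dirichlet_add_nat)
  qed
  have "(\<Sum>j<q. norm (dirichlet m (real j / real q + s)) powr p) = (\<Sum>j<q. g (j + a))"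
    unfolding g_def s by (simp add: add_divide_distrib algebra_simps)
  also have "\<dots> = (\<Sum>j<q. g j)"
    by (rule sum_lessThan_shift_periodic) (rule per)
  also have "\<dots> \<le> (\<Sum>j<q. real m powr p * ?b j + real m powr p * ?b (q - Suc j))"
    by (intro sum_mono gb) simp
  also have "\<dots> = real m powr p * (2 * (\<Sum>j<q. ?b j))"
    unfolding sum.distrib sum_distrib_left[symmetric] sum.nat_diff_reindex[of ?b q] by linarith
  also have "\<dots> \<le> real m powr p * (2 * (A + 2 + A / (p - 1)))"
    using sum_min_powr_le[OF \<open>1 < p\<close> A, of q] by (intro mult_left_mono) auto
  also have "2 * (A + 2 + A / (p - 1)) = real q / real m + 4 + real q / real m / (p - 1)"
    using assms by (simp add: A_def add_divide_distrib)
  finally show ?thesis .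
qed

section \<open>Integrals of continuous functions of period one\<close>

lemma integral_periodic_shift:
  fixes h :: "real \<Rightarrow> real"
  assumes h: "continuous_on UNIV h" and per: "\<And>x. h (x + 1) = h x"
  shows "integral {a..a + 1} h = integral {0..1} h"
proof -
  have int: "h integrable_on {u..v}" for u v
    by (intro integrable_continuous_interval continuous_on_subset[OF h]) auto
  have pern: "h (x + of_int n) = h x" for x n
  proof (induction n rule: int_induct[where k = 0])
    case (step1 i)
    then show ?case using per[of "x + of_int i"] by (simp add: add.assoc)
  next
    case (step2 i)
    then show ?case using per[of "x + of_int (i - 1)"] by (simp add: add.assoc)
  qed simp
  define r where "r = frac a"
  have r: "0 \<le> r" "r < 1" by (auto simp: r_def frac_lt_1)
  have shift: "integral {u + of_int n..v + of_int n} h = integral {u..v} h" for u v and n :: int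
    using integral_shift_real_ivl[of "u + of_int n" "of_int n" "v + of_int n" h] by (simp add: pern)
  have "integral {a..a + 1} h = integral {r..r + 1} h"
    using shift[of r "\<lfloor>a\<rfloor>" "r + 1"] by (simp add: r_def frac_def algebra_simps)
  also have "\<dots> = integral {r..1} h + integral {1..r + 1} h"
    by (rule Henstock_Kurzweil_Integration.integral_combine[symmetric]) (use r int in auto)
  also have "integral {1..r + 1} h = integral {0..r} h"
    using shift[of 0 1 r] by simp
  also have "integral {r..1} h + integral {0..r} h = integral {0..1} h"
    using Henstock_Kurzweil_Integration.integral_combine[of 0 r 1 h] r int by auto
  finally show ?thesis .
qed

lemma integral_periodic_translate:
  fixes h :: "real \<Rightarrow> real"
  assumes "continuous_on UNIV h" "\<And>x. h (x + 1) = h x"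
  shows "integral {0..1} (\<lambda>x. h (x + c)) = integral {0..1} h"
  using integral_shift_real_ivl[of c c "c + 1" h] integral_periodic_shift[OF assms, of c] by simp

lemma integral_affine:
  fixes h :: "real \<Rightarrow> real"
  assumes h: "continuous_on UNIV h" and "0 < q" "a \<le> b"
  shows "integral {a..b} (\<lambda>x. h (q * x + c)) = integral {q * a + c..q * b + c} h / q"
proof -
  have "(h has_integral integral {q * a + c..q * b + c} h) (cbox (q * a + c) (q * b + c))"
    using integrable_continuous_interval[OF continuous_on_subset[OF h]] by (simp add: integrable_integral)
  from has_integral_affinity'[OF this \<open>0 < q\<close>, of c]
  have "((\<lambda>x. h (q * x + c)) has_integral integral {q * a + c..q * b + c} h / q) {a..b}"
    using \<open>0 < q\<close> by (simp add: field_simps)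
  then show ?thesis by (rule integral_unique)
qed

lemma integral_periodic_scale:
  fixes h :: "real \<Rightarrow> real"
  assumes h: "continuous_on UNIV h" and per: "\<And>x. h (x + 1) = h x" and q: "0 < q"
  shows "integral {0..1} (\<lambda>x. h (real q * x)) = integral {0..1} h"
proof -
  have int: "h integrable_on {u..v}" for u v
    by (intro integrable_continuous_interval continuous_on_subset[OF h]) auto
  have "integral {0..real n} h = real n * integral {0..1} h" for n
  proof (induction n)
    case (Suc n)
    have "integral {0..real (Suc n)} h = integral {0..real n} h + integral {real n..real n + 1} h"
      using Henstock_Kurzweil_Integration.integral_combine[of 0 "real n" "real n + 1" h] int by (simp add: add.commute)
    then show ?case using Suc integral_periodic_shift[OF h per, of "real n"] by (simp add: algebra_simps)
  qed simp
  then show ?thesis using integral_affine[OF h, of "real q" 0 1 0] q by simp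
qed

section \<open>Rational points at which a set is dense\<close>

lemma negligible_uminus_image:
  fixes N :: "real set"
  assumes "negligible N" shows "negligible (uminus ` N)"
  by (rule negligible_differentiable_image_negligible[OF order_refl assms])
    (intro differentiable_on_minus differentiable_on_ident)

lemma lmeasurable_Int_Icc:
  "E \<in> sets lebesgue \<Longrightarrow> E \<inter> {a..b::real} \<in> lmeasurable"
  using fmeasurable_Int_fmeasurable[of "{a..b}" lebesgue E] by (simp add: Int_commute)

lemma integral_indicator_Icc:
  assumes "E \<in> sets lebesgue"
  shows "integral {a..b::real} (indicat_real E) = measure lebesgue (E \<inter> {a..b})"
  using assms by (intro integral_indicator lmeasurable_Int_Icc)

text \<open>
  Almost every point \<open>x\<close> of \<open>E\<close> is irrational and a point of density from both sides. By Dirichlet's theorem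
  infinitely many reduced fractions satisfy \<open>\<bar>x - k / q\<bar> < 1 / q\<^sup>2\<close>; the interval of radius \<open>1 / q\<^sup>2\<close> about
  \<open>k / q\<close> then lies within distance \<open>2 / q\<^sup>2\<close> of \<open>x\<close>, where \<open>E\<close> has almost full measure.
\<close>

lemma rational_density_point:
  fixes E :: "real set" and Q :: nat
  assumes E: "E \<in> sets lebesgue" "E \<subseteq> {0..<1}" "measure lebesgue E > 0" and "0 < \<eta>"
  obtains k q :: nat where "Q < q" "coprime k q"
    "{real k / q - 1 / (real q)\<^sup>2 .. real k / q + 1 / (real q)\<^sup>2} \<subseteq> {0<..<1}"
    "measure lebesgue ({real k / q - 1 / (real q)\<^sup>2 .. real k / q + 1 / (real q)\<^sup>2} - E) \<le> \<eta> / (real q)\<^sup>2"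
proof -
  have meas: "indicat_real S integrable_on cbox a b" if "S \<in> sets lebesgue" for a b :: real and S
    unfolding integrable_on_indicator using that by (simp add: lmeasurable_Int_Icc)
  have E': "uminus ` E \<in> sets lebesgue"
    using E(1) by (rule differentiable_image_in_sets_lebesgue)
      (auto intro: differentiable_on_minus differentiable_on_ident)
  obtain N1 where N1: "negligible N1"
    "\<And>x e. x \<notin> N1 \<Longrightarrow> 0 < e \<Longrightarrow> \<exists>d>0. \<forall>h. 0 < h \<and> h < d \<longrightarrow>
       norm (integral (cbox x (x + h *\<^sub>R One)) (indicat_real E) /\<^sub>R h ^ DIM(real) - indicat_real E x) < e"
    using integrable_ccontinuous_explicit[OF meas[OF E(1)]] by blast
  \<comment> \<open>\<open>N1\<close> takes care of density from the right; density from the left is that of the reflected set.\<close>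
  obtain N2 where N2: "negligible N2"
    "\<And>x e. x \<notin> N2 \<Longrightarrow> 0 < e \<Longrightarrow> \<exists>d>0. \<forall>h. 0 < h \<and> h < d \<longrightarrow>
       norm (integral (cbox x (x + h *\<^sub>R One)) (indicat_real (uminus ` E)) /\<^sub>R h ^ DIM(real) - indicat_real (uminus ` E) x) < e"
    using integrable_ccontinuous_explicit[OF meas[OF E']] by blast
  have "negligible (\<rat> :: real set)"
    unfolding negligible_iff_null_sets
    by (intro null_sets_completionI countable_imp_null_set_lborel countable_rat)
  then have "negligible (N1 \<union> uminus ` N2 \<union> \<rat>)"
    using N1 N2 negligible_uminus_image by (intro negligible_Un) auto
  moreover have "\<not> negligible E"
    using E(3) negligible_imp_measure0 by fastforce
  ultimately obtain x where x: "x \<in> E" "x \<notin> N1" "x \<notin> uminus ` N2" "x \<notin> \<rat>"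
    by (meson UnCI negligible_subset subsetI)
  have "- x \<notin> N2" using x(3) by (metis imageI minus_minus)
  have x01: "0 < x" "x < 1"
    using x E(2) by (auto simp: less_le)
  define e where "e = \<eta> / 4"
  have e: "0 < e" using \<open>0 < \<eta>\<close> by (simp add: e_def)
  obtain d1 where d1: "d1 > 0" "\<And>h. 0 < h \<Longrightarrow> h < d1 \<Longrightarrow> \<bar>measure lebesgue (E \<inter> {x..x + h}) / h - 1\<bar> < e"
    using N1(2)[OF x(2) e] x(1) by (auto simp: integral_indicator_Icc[OF E(1)] divide_inverse_commute)
  obtain d2 where d2: "d2 > 0" "\<And>h. 0 < h \<Longrightarrow> h < d2 \<Longrightarrow> \<bar>integral {- x..- x + h} (indicat_real (uminus ` E)) / h - 1\<bar> < e"
    using N2(2)[OF \<open>- x \<notin> N2\<close> e] x(1) by (auto simp: divide_inverse_commute)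
  have refl: "integral {- x..- x + h} (indicat_real (uminus ` E)) = measure lebesgue (E \<inter> {x - h..x})" for h
  proof -
    have "integral {- x..- x + h} (indicat_real (uminus ` E)) = integral {- x..- (x - h)} (\<lambda>t. indicat_real E (- t))"
      by (intro arg_cong2[where f = integral]) (auto simp: indicator_def fun_eq_iff intro: image_eqI[of _ _ "- _"])
    also have "\<dots> = measure lebesgue (E \<inter> {x - h..x})"
      by (simp only: Henstock_Kurzweil_Integration.integral_reflect_real integral_indicator_Icc[OF E(1)])
    finally show ?thesis .
  qed
  have comp: "measure lebesgue ({a..a + h} - E) \<le> e * h"
    if "0 < h" "\<bar>measure lebesgue (E \<inter> {a..a + h}) / h - 1\<bar> < e" for a h :: real
  proof -
    have "measure lebesgue ({a..a + h} - E) = measure lebesgue ({a..a + h} - (E \<inter> {a..a + h}))"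
      by (intro arg_cong2[where f = measure]) auto
    also have "\<dots> = h - measure lebesgue (E \<inter> {a..a + h})"
      using that(1) E(1) by (subst measurable_measure_Diff) auto
    also have "\<dots> \<le> e * h"
      using that by (simp add: abs_less_iff field_simps)
    finally show ?thesis .
  qed
  define K :: real where "K = real Q + 1 + 2 / d1 + 2 / d2 + 2 / x + 2 / (1 - x)"
  have pos: "0 < 2 / d1" "0 < 2 / d2" "0 < 2 / x" "0 < 2 / (1 - x)"
    using d1 d2 x01 by auto
  have "infinite (approx_set x)"
    using x(4) rational_iff_finite_approx_set by blast
  then obtain h k where hk: "(h, k) \<in> approx_set x" "k > \<lceil>K\<rceil>"
    using infinite_approx_set by blast
  then have a: "k > 0" "coprime h k" "\<bar>x - of_int h / of_int k\<bar> < 1 / (of_int k)\<^sup>2"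
    by (auto simp: approx_set_def)
  define q where "q = nat k"
  have kq: "k = int q" using a by (simp add: q_def)
  have qK: "real q > K" using hk(2) unfolding kq by linarith
  \<comment> \<open>\<open>r\<close> is the diameter of the interval about \<open>k / q\<close>; \<open>K\<close> was chosen to make it small.\<close>
  define r where "r = 2 / (real q)\<^sup>2"
  have q1: "real q > 1" using qK pos unfolding K_def by linarith
  have r_less: "r < d" if "2 / d \<le> K" "0 < d" for d
  proof -
    have "2 / d < real q" using that qK by linarith
    also have "\<dots> \<le> (real q)\<^sup>2" using q1 by (simp add: power2_eq_square)
    finally show ?thesis using that q1 by (simp add: r_def field_simps)
  qed
  have r: "r < d1" "r < d2" "r < x" "r < 1 - x" "0 < r"
    using pos d1 d2 x01 q1 by (auto intro!: r_less simp: K_def) (auto simp: r_def)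
  have near: "\<bar>x - of_int h / real q\<bar> < r / 2" using a(3) by (simp add: kq r_def)
  have "0 < of_int h / real q" using near r by linarith
  then have "h > 0" using q1 by (simp add: zero_less_divide_iff)
  define kk where "kk = nat h"
  have hkk: "h = int kk" using \<open>h > 0\<close> by (simp add: kk_def)
  have near': "\<bar>x - real kk / real q\<bar> < r / 2" using near by (simp add: hkk)
  let ?W = "{real kk / q - 1 / (real q)\<^sup>2 .. real kk / q + 1 / (real q)\<^sup>2}"
  have r2: "1 / (real q)\<^sup>2 = r / 2" by (simp add: r_def)
  have sub: "?W \<subseteq> {x - r..x + r}" unfolding r2
    by (intro iffD2[OF atLeastatMost_subset_iff] disjI2 conjI; use near' in linarith)
  show thesis
  proof (rule that)
    show "Q < q" using qK pos unfolding K_def by linarith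
    show "coprime kk q" using a(2) unfolding hkk kq by simp
    show "?W \<subseteq> {0<..<1}" using sub r by fastforce
    have "measure lebesgue (?W - E) \<le> measure lebesgue (({x - r..x - r + r} - E) \<union> ({x..x + r} - E))"
      using E(1) sub by (intro measure_mono_fmeasurable) (auto intro!: fmeasurable.Un fmeasurable_Diff)
    also have "\<dots> \<le> measure lebesgue ({x - r..x - r + r} - E) + measure lebesgue ({x..x + r} - E)"
      using E(1) by (intro measure_Un_le) auto
    also have "\<dots> \<le> e * r + e * r"
      using r d1(2)[of r] d2(2)[of r] refl[of r] by (intro add_mono comp) auto
    also have "\<dots> = \<eta> / (real q)\<^sup>2" by (simp add: e_def r_def)
    finally show "measure lebesgue (?W - E) \<le> \<eta> / (real q)\<^sup>2" .
  qed
qed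

section \<open>Products of two Dirichlet kernels\<close>

text \<open>
  The frequencies \<open>l j + q i\<close> of the product are pairwise distinct, since \<open>l j\<close> takes distinct values modulo \<open>q\<close>
  for \<open>j < m \<le> q\<close>; so all coefficients are 0 or 1.
\<close>

lemma dirichlet_product_idempotent:
  assumes "coprime l q" "0 < m" "m \<le> q" "0 < n"
  shows "(\<lambda>x. dirichlet m (real l * x) * dirichlet n (real q * x)) \<in> idempotent_polys"
proof -
  define \<phi> where "\<phi> = (\<lambda>(j, i). l * j + q * i)"
  have inj: "inj_on \<phi> ({..<m} \<times> {..<n})"
  proof (rule inj_onI, clarify)
    fix j i j' i' assume j: "j < m" "j' < m" and eq: "\<phi> (j, i) = \<phi> (j', i')"
    have *: "int l * (int j - int j') = int q * (int i' - int i)"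
      using arg_cong[OF eq, of int] by (simp add: \<phi>_def algebra_simps)
    then have "int q dvd int l * (int j - int j')" by simp
    moreover have "coprime (int q) (int l)" using assms by (simp add: coprime_commute)
    ultimately have "int q dvd int j - int j'"
      by (simp add: coprime_dvd_mult_right_iff)
    then have "j = j'"
      using j assms dvd_imp_le_int[of "int j - int j'" "int q"] by force
    moreover have "i = i'" using * \<open>j = j'\<close> assms by simp
    ultimately show "j = j' \<and> i = i'" by simp
  qed
  have "dirichlet m (real l * x) * dirichlet n (real q * x)
      = (\<Sum>t\<in>\<phi> ` ({..<m} \<times> {..<n}). unit_exp (real t * x))" for x
  proof -
    have "(\<Sum>t\<in>\<phi> ` ({..<m} \<times> {..<n}). unit_exp (real t * x))
        = (\<Sum>ji\<in>{..<m} \<times> {..<n}. unit_exp (real (\<phi> ji) * x))"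
      by (simp add: sum.reindex[OF inj])
    also have "\<dots> = (\<Sum>(j, i)\<in>{..<m} \<times> {..<n}. unit_exp (real j * (real l * x)) * unit_exp (real i * (real q * x)))"
      by (intro sum.cong) (auto simp: \<phi>_def unit_exp_add[symmetric] algebra_simps)
    also have "\<dots> = dirichlet m (real l * x) * dirichlet n (real q * x)"
      by (simp add: dirichlet_def sum_product sum.cartesian_product)
    finally show ?thesis ..
  qed
  moreover have "finite (\<phi> ` ({..<m} \<times> {..<n}))" "\<phi> ` ({..<m} \<times> {..<n}) \<noteq> {}"
    using assms by auto
  ultimately show ?thesis
    unfolding idempotent_polys_def by blast
qed

lemma exists_inverse_mod:
  assumes "coprime k q" "1 < (q::nat)"
  obtains l c where "l < q" "l * k = 1 + c * q" "coprime l q"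
proof -
  obtain u v where uv: "u * int k + v * int q = 1"
    using bezout_int[of "int k" "int q"] assms(1) by auto
  define x where "x = nat (u mod int q)"
  have "int x = u mod int q" using assms(2) by (simp add: x_def)
  then have "int (x * k) mod int q = (u * int k) mod int q"
    by (simp add: mod_mult_left_eq)
  also have "u * int k = 1 + (- v) * int q" using uv by (simp add: algebra_simps)
  also have "\<dots> mod int q = 1" using assms(2) by (simp only: mod_mult_self1) simp
  finally have "x * k mod q = 1" by (metis of_nat_1_eq_iff of_nat_mod)
  then have "(x mod q) * k mod q = 1" by (simp add: mod_mult_left_eq)
  then have eq: "(x mod q) * k = 1 + ((x mod q) * k div q) * q"
    using div_mult_mod_eq[of "(x mod q) * k" q] by simp
  have "coprime (x mod q) q"
  proof (rule coprimeI)
    fix d assume "d dvd x mod q" "d dvd q"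
    then have "d dvd 1 + ((x mod q) * k div q) * q" "d dvd ((x mod q) * k div q) * q"
      unfolding eq[symmetric] by auto
    then show "is_unit d" using dvd_add_left_iff by blast
  qed
  with eq assms(2) show thesis by (intro that[of "x mod q"]) auto
qed

lemma continuous_on_norm_powr:
  fixes f :: "real \<Rightarrow> complex"
  assumes "continuous_on A f" "0 < p"
  shows "continuous_on A (\<lambda>x. norm (f x) powr p)"
  using assms by (intro continuous_on_powr' continuous_intros) auto

text \<open>
  The next two lemmas say that, since \<open>p > 1\<close>, the norm of \<open>D\<^sub>n\<close> lives on the scale \<open>1 / n\<close> around 0: the full
  integral is at least of order \<open>n\<^sup>p\<^sup>-\<^sup>1\<close>, while the part outside \<open>[-a, a]\<close> is \<open>O(a\<^sup>1\<^sup>-\<^sup>p)\<close> uniformly in \<open>n\<close>.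
\<close>

lemma integral_dirichlet_powr_ge:
  assumes "1 < p" "0 < n"
  shows "real n powr (p - 1) / (2 * pi * 2 powr p) \<le> integral {-1/2..1/2} (\<lambda>u. norm (dirichlet n u) powr p)"
proof -
  let ?P = "\<lambda>u. norm (dirichlet n u) powr p"
  \<comment> \<open>By the Lipschitz bound \<open>\<bar>D\<^sub>n\<bar> \<ge> n / 2\<close> up to distance \<open>1 / (4 \<pi> n)\<close> from 0.\<close>
  define r where "r = 1 / (4 * pi * real n)"
  have r: "0 < r" "r \<le> 1 / 2"
  proof -
    have "1 * 1 \<le> pi * real n" using pi_ge_two assms by (intro mult_mono) auto
    then show "0 < r" "r \<le> 1 / 2" using assms by (auto simp: r_def field_simps)
  qed
  have cont: "continuous_on A ?P" for A
    using assms by (intro continuous_on_norm_powr continuous_intros) auto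
  have "real n powr (p - 1) / (2 * pi * 2 powr p) = 2 * r * (real n / 2) powr p"
    using assms by (simp add: r_def powr_diff powr_divide field_simps)
  also have "\<dots> = integral {-r..r} (\<lambda>u. (real n / 2) powr p)"
    using r by simp
  also have "\<dots> \<le> integral {-r..r} ?P"
  proof (rule integral_le)
    fix u assume u: "u \<in> {-r..r}"
    have "norm (dirichlet n 0) - norm (dirichlet n u) \<le> norm (dirichlet n 0 - dirichlet n u)"
      by (rule norm_triangle_ineq2)
    also have "\<dots> \<le> 2 * pi * real n ^ 2 * \<bar>u\<bar>"
      using dirichlet_lipschitz[of n 0 u] by simp
    also have "\<dots> \<le> 2 * pi * real n ^ 2 * r"
      using u by (intro mult_left_mono) auto
    also have "\<dots> = real n / 2"
      using assms by (simp add: r_def power2_eq_square)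
    finally have "real n / 2 \<le> norm (dirichlet n u)" by simp
    then show "(real n / 2) powr p \<le> ?P u"
      using assms by (intro powr_mono2) auto
  qed (auto intro!: integrable_continuous_interval cont)
  also have "\<dots> \<le> integral {-1/2..1/2} ?P"
    using r by (intro integral_subset_le integrable_continuous_interval cont) auto
  finally show ?thesis .
qed

lemma integral_dirichlet_powr_tail:
  assumes "1 < p" "0 < a" "a \<le> 1 / 2"
  shows "integral {-1/2..1/2} (\<lambda>u. norm (dirichlet n u) powr p) - integral {-a..a} (\<lambda>u. norm (dirichlet n u) powr p)
     \<le> a powr (1 - p) / (p - 1)"
proof -
  let ?P = "\<lambda>u. norm (dirichlet n u) powr p"
  have int: "?P integrable_on {u..v}" for u v
    using assms by (intro integrable_continuous_interval continuous_on_norm_powr continuous_intros) auto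
  have half: "2 * ((1 / 2) * X / Y) = X / Y" for X Y :: real by simp
  have "integral {-1/2..-a} ?P = integral {a..1/2} ?P"
    using Henstock_Kurzweil_Integration.integral_reflect_real[of "1/2" a ?P] by simp
  moreover have "integral {-1/2..1/2} ?P = integral {-1/2..-a} ?P + (integral {-a..a} ?P + integral {a..1/2} ?P)"
    using Henstock_Kurzweil_Integration.integral_combine[of "-1/2" "-a" "1/2" ?P]
      Henstock_Kurzweil_Integration.integral_combine[of "-a" a "1/2" ?P] assms int by auto
  ultimately have "integral {-1/2..1/2} ?P - integral {-a..a} ?P = 2 * integral {a..1/2} ?P" by simp
  also have "integral {a..1/2} ?P \<le> (1 / 2) * (a powr (1 - p) - (1 / 2) powr (1 - p)) / (p - 1)"
  proof (rule has_integral_le)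
    show "(?P has_integral integral {a..1/2} ?P) {a..1/2}"
      using int by (rule integrable_integral)
    have "((\<lambda>u. (1 / 2) * u powr (- p)) has_integral
        ((1 / 2) * (- ((1 / 2) powr (1 - p)) / (p - 1)) - (1 / 2) * (- (a powr (1 - p)) / (p - 1)))) {a..1/2}"
    proof (rule fundamental_theorem_of_calculus)
      fix u assume "u \<in> {a..1/2}"
      then have "((\<lambda>u. (1 / 2) * (- (u powr (1 - p)) / (p - 1))) has_real_derivative (1 / 2) * (- ((1 - p) * u powr (1 - p - 1)) / (p - 1))) (at u)"
        using assms by (intro DERIV_cmult DERIV_cdivide DERIV_minus has_real_derivative_powr) auto
      also have "(1 / 2) * (- ((1 - p) * u powr (1 - p - 1)) / (p - 1)) = (1 / 2) * u powr (- p)"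
        using assms by (simp add: field_simps)
      finally show "((\<lambda>u. (1 / 2) * (- (u powr (1 - p)) / (p - 1))) has_vector_derivative (1 / 2) * u powr (- p)) (at u within {a..1/2})"
        by (simp add: has_real_derivative_iff_has_vector_derivative has_vector_derivative_at_within)
    qed (use assms in auto)
    then show "((\<lambda>u. (1 / 2) * u powr (- p)) has_integral (1 / 2) * (a powr (1 - p) - (1 / 2) powr (1 - p)) / (p - 1)) {a..1/2}"
      by (simp add: diff_divide_distrib algebra_simps)
  next
    fix u assume u: "u \<in> {a..1/2}"
    then have "?P u \<le> (1 / (2 * u)) powr p"
      using assms by (intro powr_mono2 norm_dirichlet_le_inverse) auto
    also have "\<dots> = (1 / 2) powr p * u powr (- p)"
      by (simp add: powr_divide powr_mult powr_minus field_simps)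
    also have "\<dots> \<le> (1 / 2) powr 1 * u powr (- p)"
      using assms by (intro mult_right_mono powr_mono') auto
    finally show "?P u \<le> (1 / 2) * u powr (- p)" by simp
  qed
  also have "2 * ((1 / 2) * (a powr (1 - p) - (1 / 2) powr (1 - p)) / (p - 1)) = (a powr (1 - p) - (1 / 2) powr (1 - p)) / (p - 1)"
    using half[of "a powr (1 - p) - (1 / 2) powr (1 - p)" "p - 1"] .
  also have "\<dots> \<le> a powr (1 - p) / (p - 1)"
    using assms by (intro divide_right_mono) auto
  finally show ?thesis by simp
qed

text \<open>
  The integrand has period 1, so it may be translated by \<open>k j / q\<close> for each \<open>j < q\<close> and the results averaged. The
  translation leaves \<open>D\<^sub>n(q x)\<close> unchanged and, because \<open>l k\<close> is 1 modulo \<open>q\<close>, turns \<open>D\<^sub>m(l x)\<close> into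
  \<open>D\<^sub>m(l x + j / q)\<close>; the average is thus governed by the moments of \<open>D\<^sub>m\<close> over a coset of the \<open>q\<close>-th
  roots of unity.
\<close>

lemma integral_modulated_dirichlet_le:
  fixes p h :: real
  assumes p: "1 < p" and q: "0 < q" and lk: "l * k = 1 + c * q"
    and moments: "\<And>s. 0 \<le> s \<Longrightarrow> (\<Sum>j<q. norm (dirichlet m (real j / real q + s)) powr p) \<le> real q powr p * h"
  shows "integral {0..1} (\<lambda>x. norm (dirichlet m (real l * x) * dirichlet n (real q * x)) powr p)
    \<le> real q powr (p - 1) * h * integral {-1/2..1/2} (\<lambda>u. norm (dirichlet n u) powr p)"
proof -
  let ?D = "\<lambda>x. norm (dirichlet m x) powr p"
  let ?P = "\<lambda>x. norm (dirichlet n x) powr p"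
  define g where "g x = ?D (real l * x) * ?P (real q * x)" for x
  have g: "g x = norm (dirichlet m (real l * x) * dirichlet n (real q * x)) powr p" for x
    by (simp add: g_def norm_mult powr_mult)
  have contD: "continuous_on A (\<lambda>x. ?D (f x))" if "continuous_on A f" for A and f :: "real \<Rightarrow> real"
    using that p by (intro continuous_on_norm_powr continuous_intros) auto
  have contP: "continuous_on A (\<lambda>x. ?P (f x))" if "continuous_on A f" for A and f :: "real \<Rightarrow> real"
    using that p by (intro continuous_on_norm_powr continuous_intros) auto
  have contg: "continuous_on UNIV g"
    unfolding g_def by (intro continuous_intros contD contP)
  have per: "g (x + 1) = g x" for x
    by (simp add: g_def ring_distribs)
  have perP: "?P (x + 1) = ?P x" for x
    using dirichlet_add_nat[of n x 1] by simp
  have shift: "g (x + real (k * j) / real q) = ?D (real j / real q + real l * x) * ?P (real q * x)" for x j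
  proof -
    have "real l * real k = 1 + real c * real q"
      using arg_cong[OF lk, of real] by simp
    then have "real l * (x + real (k * j) / real q) = (real j / real q + real l * x) + real (c * j)"
      using q by (simp add: field_simps)
    moreover have "real q * (x + real (k * j) / real q) = real q * x + real (k * j)"
      using q by (simp add: field_simps)
    ultimately show ?thesis unfolding g_def by (simp only: dirichlet_add_nat)
  qed
  have "real q * integral {0..1} g = (\<Sum>j<q. integral {0..1} (\<lambda>x. g (x + real (k * j) / real q)))"
    by (simp add: integral_periodic_translate[OF contg per])
  also have "\<dots> = integral {0..1} (\<lambda>x. \<Sum>j<q. g (x + real (k * j) / real q))"
    by (intro integral_sum[symmetric] integrable_continuous_interval continuous_on_compose2[OF contg] continuous_intros) auto
  also have "\<dots> = integral {0..1} (\<lambda>x. (\<Sum>j<q. ?D (real j / real q + real l * x)) * ?P (real q * x))"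
    unfolding shift by (simp add: sum_distrib_right)
  also have "\<dots> \<le> integral {0..1} (\<lambda>x. (real q powr p * h) * ?P (real q * x))"
  proof (rule integral_le)
    fix x :: real assume "x \<in> {0..1}"
    then show "(\<Sum>j<q. ?D (real j / real q + real l * x)) * ?P (real q * x) \<le> (real q powr p * h) * ?P (real q * x)"
      by (intro mult_right_mono moments) auto
  qed (auto intro!: integrable_continuous_interval continuous_intros contD contP)
  also have "\<dots> = (real q powr p * h) * integral {0..1} (\<lambda>x. ?P (real q * x))"
    by simp
  also have "integral {0..1} (\<lambda>x. ?P (real q * x)) = integral {0..1} ?P"
    using integral_periodic_scale[OF contP[OF continuous_on_id], OF perP q] .
  also have "\<dots> = integral {-1/2..1/2} ?P"
    using integral_periodic_shift[OF contP[OF continuous_on_id], OF perP, of "-1/2"] by simp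
  finally have "real q * integral {0..1} g \<le> real q * (real q powr (p - 1) * h * integral {-1/2..1/2} ?P)"
    using q by (simp add: powr_diff)
  then show ?thesis using q unfolding g[symmetric] by simp
qed

text \<open>
  The quantitative heart of the argument. Here \<open>\<eta>\<close> measures the part of the interval about \<open>k / q\<close> missed by
  \<open>E\<close>, the smaller interval of radius \<open>\<delta> / q\<^sup>2\<close> is where \<open>D\<^sub>m(l x)\<close> stays close to its value at \<open>k / q\<close>,
  \<open>h\<close> bounds the normalised moments, and \<open>\<gamma>\<close> is a lower bound for \<open>\<bar>D\<^sub>m(l x)\<bar> / q\<close> on that interval.
  The two error terms come from the tail of \<open>D\<^sub>n\<close> and from the missed part of the interval.
\<close>

lemma concentration_near_rational:
  fixes p h \<delta> \<eta> \<gamma> :: real and k q m n :: nat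
  assumes p: "1 < p" and q: "1 < q" "coprime k q" and m: "0 < m" "m \<le> q" and n: "0 < n"
    and \<delta>: "0 < \<delta>" "\<delta> \<le> 1" and h: "0 < h"
    and E: "E \<in> sets lebesgue" "E \<subseteq> {0..<1}"
    and sub: "{real k / q - 1 / (real q)\<^sup>2 .. real k / q + 1 / (real q)\<^sup>2} \<subseteq> {0<..<1}"
    and dense: "measure lebesgue ({real k / q - 1 / (real q)\<^sup>2 .. real k / q + 1 / (real q)\<^sup>2} - E) \<le> \<eta> / (real q)\<^sup>2"
    and moments: "\<And>s. 0 \<le> s \<Longrightarrow> (\<Sum>j<q. norm (dirichlet m (real j / real q + s)) powr p) \<le> real q powr p * h"
    and \<gamma>: "0 \<le> \<gamma>" "\<gamma> \<le> sin (pi * (real m / real q)) / pi - 2 * pi * \<delta>"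
  shows "\<exists>f\<in>idempotent_polys. \<gamma> powr p / h *
    (1 - 2 * pi * 2 powr p * ((real n * \<delta> / q) powr (1 - p) / (p - 1) + real n * \<eta> / q)) \<le> Lp_ratio p E f"
proof -
  obtain l c where l: "l < q" "l * k = 1 + c * q" "coprime l q"
    using exists_inverse_mod[OF q(2) q(1)] by blast
  define f where "f = (\<lambda>x. dirichlet m (real l * x) * dirichlet n (real q * x))"
  have f: "f \<in> idempotent_polys"
    unfolding f_def by (rule dirichlet_product_idempotent) (use l m n in auto)
  let ?P = "\<lambda>x. norm (dirichlet n x) powr p"
  define g where "g x = norm (f x) powr p" for x
  have contP: "continuous_on A (\<lambda>x. ?P (f x))" if "continuous_on A f" for A and f :: "real \<Rightarrow> real"
    using that p by (intro continuous_on_norm_powr continuous_intros) auto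
  have contg: "continuous_on A g" for A
    unfolding g_def f_def using p by (intro continuous_on_norm_powr continuous_intros) auto
  have g0: "0 \<le> g x" for x by (simp add: g_def)
  have gI: "set_integrable lebesgue S g" if "S \<in> sets lebesgue" "S \<subseteq> {0..1}" for S
    using absolutely_integrable_continuous_real[OF contg, of 0 1] that by (rule set_integrable_subset)
  have EI: "set_integrable lebesgue E g"
    using E by (intro gI) auto
  define a where "a = \<delta> / real q"
  have a: "0 < a" "a \<le> 1 / 2" using \<delta> q by (auto simp: a_def field_simps)
  define A where "A = integral {-1/2..1/2} ?P"
  define C where "C = 2 * pi * 2 powr p"
  have C: "0 < C" by (simp add: C_def)
  have A: "real n powr (p - 1) / C \<le> A"
    unfolding A_def C_def by (rule integral_dirichlet_powr_ge[OF p n])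
  have A0: "0 < A"
    using A C n by (smt (verit) divide_pos_pos of_nat_0_less_iff powr_gt_zero)
  have circle_eq: "(LINT x:circle|lebesgue. g x) = integral {0..1} g"
  proof -
    have "(LINT x:circle|lebesgue. g x) = integral {0..<1} g"
      unfolding circle_def by (intro set_lebesgue_integral_eq_integral gI) auto
    also have "\<dots> = integral {0..1} g"
      by (rule integral_subset_negligible) (auto intro: negligible_subset[of "{1}"])
    finally show ?thesis .
  qed
  have denom: "(LINT x:circle|lebesgue. g x) \<le> real q powr (p - 1) * h * A"
    unfolding circle_eq A_def unfolding g_def f_def
    by (rule integral_modulated_dirichlet_le[OF p _ l(2) moments]) (use q in auto)
  have num_le: "(LINT x:E|lebesgue. g x) \<le> (LINT x:circle|lebesgue. g x)"
    unfolding set_lebesgue_integral_def using EI gI[of circle] E g0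
    by (intro integral_mono) (auto simp: set_integrable_def circle_def indicator_def subset_eq)
  define W where "W = {real k / q - \<delta> / (real q)\<^sup>2 .. real k / q + \<delta> / (real q)\<^sup>2}"
  have W1: "W \<subseteq> {real k / q - 1 / (real q)\<^sup>2 .. real k / q + 1 / (real q)\<^sup>2}"
    unfolding W_def using \<delta> q by (auto simp: atLeastatMost_subset_iff divide_right_mono)
  have W01: "W \<subseteq> {0..1}" using W1 sub by fastforce
  have WE: "measure lebesgue (W - E) \<le> \<eta> / (real q)\<^sup>2"
  proof -
    have "measure lebesgue (W - E) \<le> measure lebesgue ({real k / q - 1 / (real q)\<^sup>2 .. real k / q + 1 / (real q)\<^sup>2} - E)"
      using W1 E by (intro measure_mono_fmeasurable) (auto simp: W_def intro!: fmeasurable_Diff)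
    then show ?thesis using dense by simp
  qed
  have factor: "real q * \<gamma> \<le> norm (dirichlet m (real l * x))" if "x \<in> W" for x
  proof -
    define t where "t = x - real k / q"
    have t: "\<bar>t\<bar> \<le> \<delta> / (real q)\<^sup>2" using that unfolding W_def t_def abs_le_iff by auto
    have "real l * real k = 1 + real c * real q"
      using arg_cong[OF l(2), of real] by simp
    then have "real l * x = (1 / real q + real l * t) + real c"
      using q by (simp add: t_def field_simps)
    then have eq: "dirichlet m (real l * x) = dirichlet m (1 / real q + real l * t)"
      by (simp only: dirichlet_add_nat)
    have "norm (dirichlet m (1 / real q)) - norm (dirichlet m (1 / real q + real l * t))
        \<le> norm (dirichlet m (1 / real q) - dirichlet m (1 / real q + real l * t))"
      by (rule norm_triangle_ineq2)
    also have "\<dots> \<le> 2 * pi * real m ^ 2 * \<bar>1 / real q - (1 / real q + real l * t)\<bar>"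
      by (rule dirichlet_lipschitz)
    also have "\<dots> = 2 * pi * real m ^ 2 * (real l * \<bar>t\<bar>)"
      by (simp add: abs_mult)
    also have "\<dots> \<le> 2 * pi * real q ^ 2 * (real q * (\<delta> / (real q)\<^sup>2))"
      using t m l by (intro mult_mono power_mono) auto
    also have "\<dots> = real q * (2 * pi * \<delta>)"
      using q by (simp add: power2_eq_square)
    finally have "norm (dirichlet m (1 / real q)) - real q * (2 * pi * \<delta>) \<le> norm (dirichlet m (real l * x))"
      using eq by simp
    moreover have "real q * (sin (pi * (real m / real q)) / pi) \<le> norm (dirichlet m (1 / real q))"
      by (rule norm_dirichlet_inverse_ge[OF m])
    moreover have "real q * \<gamma> \<le> real q * (sin (pi * (real m / real q)) / pi - 2 * pi * \<delta>)"
      using \<gamma>(2) by (intro mult_left_mono) auto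
    ultimately show ?thesis by (simp add: right_diff_distrib)
  qed
  define K where "K = (real q * \<gamma>) powr p"
  have K: "0 \<le> K" by (simp add: K_def)
  have gW: "K * ?P (real q * x) \<le> g x" if "x \<in> W" for x
  proof -
    have "K \<le> norm (dirichlet m (real l * x)) powr p"
      unfolding K_def using factor[OF that] p \<gamma> by (intro powr_mono2) auto
    then have "K * ?P (real q * x) \<le> norm (dirichlet m (real l * x)) powr p * ?P (real q * x)"
      by (intro mult_right_mono) auto
    then show ?thesis by (simp add: g_def f_def norm_mult powr_mult)
  qed
  have Pn: "?P x \<le> real n powr p" for x
    using p by (intro powr_mono2 norm_dirichlet_le) auto
  have WI: "set_integrable lebesgue W (\<lambda>x. ?P (real q * x))"
    unfolding W_def by (intro absolutely_integrable_continuous_real contP continuous_intros)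
  have WEm: "W - E \<in> lmeasurable"
    using E by (auto simp: W_def intro!: fmeasurable_Diff)
  have WEI: "set_integrable lebesgue (W - E) (\<lambda>x. real n powr p)"
    unfolding set_integrable_def using WEm
    by (intro integrable_scaleR_left integrable_real_indicator) (auto simp: fmeasurable_def)
  \<comment> \<open>On \<open>W\<close> outside \<open>E\<close> the loss is estimated by the trivial bound \<open>\<bar>D\<^sub>n\<bar> \<le> n\<close>.\<close>
  have "K * ((LINT x:W|lebesgue. ?P (real q * x)) - real n powr p * measure lebesgue (W - E))
      = (LINT x|lebesgue. K * (indicator W x *\<^sub>R ?P (real q * x) - indicator (W - E) x *\<^sub>R real n powr p))"
    using WI WEI WEm unfolding set_lebesgue_integral_def set_integrable_def by (simp add: mult.commute)
  also have "\<dots> \<le> (LINT x:E|lebesgue. g x)"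
    unfolding set_lebesgue_integral_def
  proof (rule integral_mono)
    show "integrable lebesgue (\<lambda>x. K * (indicator W x *\<^sub>R ?P (real q * x) - indicator (W - E) x *\<^sub>R real n powr p))"
      using WI WEI unfolding set_integrable_def by (intro integrable_mult_right Bochner_Integration.integrable_diff)
    show "integrable lebesgue (\<lambda>x. indicat_real E x *\<^sub>R g x)"
      using EI unfolding set_integrable_def .
    fix x
    have "K * (?P (real q * x) - real n powr p) \<le> 0"
      using K Pn[of "real q * x"] by (intro mult_nonneg_nonpos) auto
    then show "K * (indicator W x *\<^sub>R ?P (real q * x) - indicator (W - E) x *\<^sub>R real n powr p) \<le> indicat_real E x *\<^sub>R g x"
      using gW[of x] g0[of x] by (cases "x \<in> W"; cases "x \<in> E") auto
  qed
  finally have num1: "K * ((LINT x:W|lebesgue. ?P (real q * x)) - real n powr p * measure lebesgue (W - E))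
      \<le> (LINT x:E|lebesgue. g x)" .
  have "(LINT x:W|lebesgue. ?P (real q * x)) = integral W (\<lambda>x. ?P (real q * x))"
    by (rule set_lebesgue_integral_eq_integral[OF WI])
  also have "\<dots> = integral {real q * (real k / q - \<delta> / (real q)\<^sup>2)..real q * (real k / q + \<delta> / (real q)\<^sup>2)} ?P / real q"
    using integral_affine[of ?P "real q" "real k / q - \<delta> / (real q)\<^sup>2" "real k / q + \<delta> / (real q)\<^sup>2" 0] contP[OF continuous_on_id] q \<delta>
    by (simp add: W_def)
  also have "real q * (real k / q - \<delta> / (real q)\<^sup>2) = - a + real k"
    using q by (simp add: a_def power2_eq_square right_diff_distrib)
  also have "real q * (real k / q + \<delta> / (real q)\<^sup>2) = a + real k"
    using q by (simp add: a_def power2_eq_square distrib_left)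
  also have "integral {- a + real k..a + real k} ?P = integral {- a..a} ?P"
    using integral_shift_real_ivl[of "- a + real k" "real k" "a + real k" ?P] by simp
  finally have peak: "(LINT x:W|lebesgue. ?P (real q * x)) = integral {- a..a} ?P / real q" .
  have tail: "A - a powr (1 - p) / (p - 1) \<le> integral {- a..a} ?P"
    using integral_dirichlet_powr_tail[OF p a, of n] unfolding A_def by linarith
  define \<tau> where "\<tau> = C * ((real n * \<delta> / q) powr (1 - p) / (p - 1) + real n * \<eta> / q)"
  have err: "a powr (1 - p) / (p - 1) + real n powr p * \<eta> / real q \<le> \<tau> * A"
  proof -
    have eta: "0 \<le> \<eta>"
    proof -
      have "0 \<le> \<eta> / (real q)\<^sup>2" using WE measure_nonneg order_trans by blast
      then show ?thesis using q by (simp add: zero_le_divide_iff)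
    qed
    have t0: "0 \<le> (real n * \<delta> / q) powr (1 - p) / (p - 1) + real n * \<eta> / q"
      using p eta by (intro add_nonneg_nonneg) auto
    have e: "real n * \<delta> / q = real n * a" by (simp add: a_def)
    have "real n powr (p - 1) * (real n * a) powr (1 - p) = a powr (1 - p)"
      using n by (simp add: powr_mult powr_add[symmetric] mult.assoc[symmetric])
    moreover have "real n powr (p - 1) * real n = real n powr p"
      using n by (simp add: powr_diff)
    ultimately have "a powr (1 - p) / (p - 1) + real n powr p * \<eta> / real q
      = real n powr (p - 1) * ((real n * \<delta> / q) powr (1 - p) / (p - 1) + real n * \<eta> / q)"
      unfolding e distrib_left by (metis (no_types, lifting) mult.assoc times_divide_eq_right)
    also have "\<dots> \<le> (C * A) * ((real n * \<delta> / q) powr (1 - p) / (p - 1) + real n * \<eta> / q)"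
      using A C t0 by (intro mult_right_mono) (auto simp: field_simps)
    finally show ?thesis by (simp add: \<tau>_def mult_ac)
  qed
  have "K / real q * (A * (1 - \<tau>)) \<le> K / real q * (integral {- a..a} ?P - real n powr p * \<eta> / real q)"
    using err tail K by (intro mult_left_mono) (auto simp: algebra_simps)
  also have "\<dots> = K * (integral {- a..a} ?P / real q - real n powr p * (\<eta> / (real q)\<^sup>2))"
    using q by (simp add: field_simps power2_eq_square)
  also have "\<dots> \<le> K * (integral {- a..a} ?P / real q - real n powr p * measure lebesgue (W - E))"
    using WE K by (intro mult_left_mono diff_left_mono) auto
  also have "\<dots> \<le> (LINT x:E|lebesgue. g x)"
    using num1 unfolding peak .
  finally have num: "K / real q * (A * (1 - \<tau>)) \<le> (LINT x:E|lebesgue. g x)" .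
  have target: "\<gamma> powr p / h * (1 - \<tau>) = (K / real q * (A * (1 - \<tau>))) / (real q powr (p - 1) * h * A)"
    using A0 h q \<gamma> by (simp add: K_def powr_mult powr_diff)
  have numer0: "0 \<le> (LINT x:E|lebesgue. g x)"
    unfolding set_lebesgue_integral_def by (intro integral_nonneg_AE) (auto simp: g0)
  have "\<gamma> powr p / h * (1 - \<tau>) \<le> (LINT x:E|lebesgue. g x) / (LINT x:circle|lebesgue. g x)"
  proof (cases "0 < K / real q * (A * (1 - \<tau>))")
    case True
    then have "0 < (LINT x:circle|lebesgue. g x)" using num num_le by linarith
    then show ?thesis unfolding target
      using True num denom by (intro frac_le) auto
  next
    case False
    then have "\<gamma> powr p / h * (1 - \<tau>) \<le> 0"
      unfolding target using h A0 by (intro divide_nonpos_nonneg) auto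
    also have "0 \<le> (LINT x:E|lebesgue. g x) / (LINT x:circle|lebesgue. g x)"
      using numer0 num_le by (intro divide_nonneg_nonneg) auto
    finally show ?thesis .
  qed
  then show ?thesis
    unfolding Lp_ratio_def g_def \<tau>_def C_def using f by (intro bexI[of _ f]) auto
qed

section \<open>Concentration levels obtained from moment bounds\<close>

text \<open>
  Any bound \<open>q\<^sup>p H(m / q)\<close> for the moments of \<open>D\<^sub>m\<close>, with \<open>H\<close> continuous, yields a concentration level: let \<open>q\<close>
  tend to infinity with \<open>m / q\<close> tending to \<open>\<omega>\<close>.
\<close>

lemma concentration_limit:
  fixes p \<omega> v :: real and H :: "real \<Rightarrow> real"
  assumes p: "1 < p" and \<omega>: "0 < \<omega>" "\<omega> < 1"
    and H: "isCont H \<omega>" "\<And>w. 0 < w \<Longrightarrow> 0 < H w"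
    and moments: "\<And>m q s. 0 < m \<Longrightarrow> m \<le> q \<Longrightarrow> 0 \<le> s \<Longrightarrow>
      (\<Sum>j<q. norm (dirichlet m (real j / real q + s)) powr p) \<le> real q powr p * H (real m / real q)"
    and E: "E \<in> sets lebesgue" "E \<subseteq> circle" "measure lebesgue E > 0"
    and v: "v < (sin (pi * \<omega>) / pi) powr p / H \<omega>"
  shows "\<exists>f\<in>idempotent_polys. v < Lp_ratio p E f"
proof -
  define C where "C = 2 * pi * 2 powr p"
  have step: "\<exists>w f. f \<in> idempotent_polys \<and> \<bar>w - \<omega>\<bar> \<le> 1 / real (Suc N) \<and>
     (max 0 (sin (pi * w) / pi - 2 * pi * (1 / real (Suc N)))) powr p / H w *
     (1 - C * (real (Suc N) powr (1 - p) / (p - 1) + 1 / real (Suc N))) \<le> Lp_ratio p E f" for N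
  proof -
    define r where "r = real (Suc N)"
    have r: "1 \<le> r" by (simp add: r_def)
    then have r3: "0 < 1 / r ^ 3" by simp
    obtain k q :: nat where kq: "Suc N < q" "coprime k q"
      "{real k / q - 1 / (real q)\<^sup>2 .. real k / q + 1 / (real q)\<^sup>2} \<subseteq> {0<..<1}"
      "measure lebesgue ({real k / q - 1 / (real q)\<^sup>2 .. real k / q + 1 / (real q)\<^sup>2} - E) \<le> (1 / r ^ 3) / (real q)\<^sup>2"
      using rational_density_point[OF E(1) E(2)[unfolded circle_def] E(3) r3, of "Suc N"] by metis
    have q: "1 < q" "r \<le> real q" using kq(1) by (auto simp: r_def)
    define m where "m = nat \<lceil>\<omega> * real q\<rceil>"
    have wq: "0 < \<omega> * real q" "\<omega> * real q \<le> real q" using \<omega> q by auto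
    have m: "\<omega> * real q \<le> real m" "real m \<le> \<omega> * real q + 1" "0 < m"
      using wq(1) unfolding m_def by linarith+
    have mq: "m \<le> q" using wq(2) unfolding m_def by linarith
    \<comment> \<open>With \<open>\<delta> = 1 / r\<close>, \<open>n = r\<^sup>2 q\<close> and \<open>\<eta> = 1 / r\<^sup>3\<close> the quantities \<open>n \<delta> / q\<close> and \<open>n \<eta> / q\<close>
      in the error terms are \<open>r\<close> and \<open>1 / r\<close>.\<close>
    define n where "n = Suc N ^ 2 * q"
    have n: "real n = r ^ 2 * real q" "0 < n" using q by (auto simp: n_def r_def)
    define w where "w = real m / real q"
    have w: "0 < w" using m q by (simp add: w_def)
    have "w - \<omega> = (real m - \<omega> * real q) / real q" using q by (simp add: w_def field_simps)
    then have "\<bar>w - \<omega>\<bar> \<le> 1 / real q" using m q by (simp add: abs_le_iff field_simps)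
    also have "\<dots> \<le> 1 / r" using q r by (intro divide_left_mono) auto
    finally have near: "\<bar>w - \<omega>\<bar> \<le> 1 / r" .
    define \<gamma> where "\<gamma> = max 0 (sin (pi * w) / pi - 2 * pi * (1 / r))"
    have nonneg_case: ?thesis if "sin (pi * w) / pi - 2 * pi * (1 / r) < 0"
    proof -
      have "(\<lambda>x. dirichlet 1 (real 1 * x) * dirichlet 1 (real 1 * x)) \<in> idempotent_polys"
        by (rule dirichlet_product_idempotent) auto
      moreover have "0 \<le> Lp_ratio p E f" for f
        unfolding Lp_ratio_def set_lebesgue_integral_def
        by (intro divide_nonneg_nonneg integral_nonneg_AE) auto
      moreover have "\<gamma> = 0" using that by (simp add: \<gamma>_def)
      ultimately show ?thesis using near p unfolding r_def \<gamma>_def by (intro exI[of _ w]) auto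
    qed
    have "?thesis" if *: "0 \<le> sin (pi * w) / pi - 2 * pi * (1 / r)"
    proof -
      have g: "0 \<le> \<gamma>" "\<gamma> \<le> sin (pi * (real m / real q)) / pi - 2 * pi * (1 / r)"
        using * by (auto simp: \<gamma>_def w_def)
      have "\<exists>f\<in>idempotent_polys. \<gamma> powr p / H w *
        (1 - 2 * pi * 2 powr p * ((real n * (1 / r) / q) powr (1 - p) / (p - 1) + real n * (1 / r ^ 3) / q)) \<le> Lp_ratio p E f"
      proof (rule concentration_near_rational[OF p q(1) kq(2) m(3) mq n(2) _ _ H(2)[OF w] E(1) _ kq(3) kq(4) _ g])
        show "(\<Sum>j<q. norm (dirichlet m (real j / real q + s)) powr p) \<le> real q powr p * H w" if "0 \<le> s" for s
          unfolding w_def by (rule moments[OF m(3) mq that])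
      qed (use r E(2) in \<open>auto simp: circle_def\<close>)
      moreover have "real n * (1 / r) / q = r" "real n * (1 / r ^ 3) / q = 1 / r"
        using r q by (auto simp: n(1) power2_eq_square power3_eq_cube)
      ultimately show ?thesis using near unfolding r_def C_def \<gamma>_def by fastforce
    qed
    then show ?thesis using nonneg_case not_le by blast
  qed
  obtain W F where WF: "\<And>N. F N \<in> idempotent_polys" "\<And>N. \<bar>W N - \<omega>\<bar> \<le> 1 / real (Suc N)"
    "\<And>N. (max 0 (sin (pi * W N) / pi - 2 * pi * (1 / real (Suc N)))) powr p / H (W N) *
     (1 - C * (real (Suc N) powr (1 - p) / (p - 1) + 1 / real (Suc N))) \<le> Lp_ratio p E (F N)"
    using step by metis
  have inv: "(\<lambda>N. 1 / real (Suc N)) \<longlonglongrightarrow> 0"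
    using LIMSEQ_inverse_real_of_nat by (simp add: inverse_eq_divide)
  have "(\<lambda>N. W N - \<omega>) \<longlonglongrightarrow> 0"
    by (rule Lim_null_comparison[OF _ inv]) (use WF(2) in auto)
  then have Wlim: "W \<longlonglongrightarrow> \<omega>" by (simp add: LIM_zero_iff)
  have Hlim: "(\<lambda>N. H (W N)) \<longlonglongrightarrow> H \<omega>"
    using isCont_tendsto_compose[OF H(1) Wlim] .
  have powlim: "(\<lambda>N. real (Suc N) powr (1 - p)) \<longlonglongrightarrow> 0"
    using p by (intro tendsto_neg_powr filterlim_compose[OF filterlim_real_sequentially] filterlim_Suc) auto
  have s: "0 < sin (pi * \<omega>) / pi" using \<omega> by (intro divide_pos_pos sin_gt_zero) auto
  have "(\<lambda>N. (max 0 (sin (pi * W N) / pi - 2 * pi * (1 / real (Suc N)))) powr p / H (W N) *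
     (1 - C * (real (Suc N) powr (1 - p) / (p - 1) + 1 / real (Suc N))))
     \<longlonglongrightarrow> (max 0 (sin (pi * \<omega>) / pi - 2 * pi * 0)) powr p / H \<omega> * (1 - C * (0 / (p - 1) + 0))"
    using s H(2)[OF \<omega>(1)] p by (intro tendsto_intros Wlim Hlim powlim inv) auto
  then have "(\<lambda>N. (max 0 (sin (pi * W N) / pi - 2 * pi * (1 / real (Suc N)))) powr p / H (W N) *
     (1 - C * (real (Suc N) powr (1 - p) / (p - 1) + 1 / real (Suc N))))
     \<longlonglongrightarrow> (sin (pi * \<omega>) / pi) powr p / H \<omega>" using s by simp
  from order_tendstoD(1)[OF this v]
  obtain N where "v < (max 0 (sin (pi * W N) / pi - 2 * pi * (1 / real (Suc N)))) powr p / H (W N) *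
     (1 - C * (real (Suc N) powr (1 - p) / (p - 1) + 1 / real (Suc N)))"
    using eventually_happens by fastforce
  then show ?thesis using WF(1)[of N] WF(3)[of N] by (intro bexI[of _ "F N"]) linarith+
qed

lemma concentration_ge_2:
  fixes p \<omega> v :: real
  assumes p: "2 \<le> p" and \<omega>: "0 < \<omega>" "\<omega> < 1"
    and E: "E \<in> sets lebesgue" "E \<subseteq> circle" "measure lebesgue E > 0"
    and v: "v < (sin (pi * \<omega>) / pi) powr p / \<omega> powr (p - 1)"
  shows "\<exists>f\<in>idempotent_polys. v < Lp_ratio p E f"
proof (rule concentration_limit[OF _ \<omega> _ _ _ E, where H = "\<lambda>w. w powr (p - 1)"])
  show "isCont (\<lambda>w. w powr (p - 1)) \<omega>" using \<omega> by (intro continuous_intros) auto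
  fix m q :: nat and s :: real assume mq: "0 < m" "m \<le> q"
  have "(\<Sum>j<q. norm (dirichlet m (real j / real q + s)) powr p) \<le> real q * real m powr (p - 1)"
    by (rule sum_dirichlet_powr_ge_2[OF p mq])
  also have "\<dots> = real q powr p * (real m / real q) powr (p - 1)"
    using mq by (simp add: powr_divide powr_diff)
  finally show "(\<Sum>j<q. norm (dirichlet m (real j / real q + s)) powr p) \<le> real q powr p * (real m / real q) powr (p - 1)" .
qed (use p v in auto)

lemma concentration_gt_1:
  fixes p \<omega> v :: real
  assumes p: "1 < p" and \<omega>: "0 < \<omega>" "\<omega> < 1"
    and E: "E \<in> sets lebesgue" "E \<subseteq> circle" "measure lebesgue E > 0"
    and v: "v < (sin (pi * \<omega>) / (pi * \<omega>)) powr p / (1 / \<omega> + 4 + 1 / \<omega> / (p - 1))"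
  shows "\<exists>f\<in>idempotent_polys. v < Lp_ratio p E f"
proof (rule concentration_limit[OF p \<omega> _ _ _ E, where H = "\<lambda>w. w powr p * (1 / w + 4 + 1 / w / (p - 1))"])
  show "isCont (\<lambda>w. w powr p * (1 / w + 4 + 1 / w / (p - 1))) \<omega>"
    using \<omega> p by (intro continuous_intros) auto
  show "0 < w powr p * (1 / w + 4 + 1 / w / (p - 1))" if "0 < w" for w
    using that p by (intro mult_pos_pos add_pos_pos) auto
  fix m q :: nat and s :: real assume mq: "0 < m" "m \<le> q" "0 \<le> s"
  have "(\<Sum>j<q. norm (dirichlet m (real j / real q + s)) powr p)
      \<le> real m powr p * (real q / real m + 4 + real q / real m / (p - 1))"
    by (rule sum_dirichlet_powr_gt_1[OF p mq])
  also have "\<dots> = real q powr p * ((real m / real q) powr p * (1 / (real m / real q) + 4 + 1 / (real m / real q) / (p - 1)))"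
    using mq by (simp add: powr_divide)
  finally show "(\<Sum>j<q. norm (dirichlet m (real j / real q + s)) powr p)
    \<le> real q powr p * ((real m / real q) powr p * (1 / (real m / real q) + 4 + 1 / (real m / real q) / (p - 1)))" .
next
  have "(sin (pi * \<omega>) / (pi * \<omega>)) powr p = ((sin (pi * \<omega>) / pi) / \<omega>) powr p" by simp
  also have "\<dots> = (sin (pi * \<omega>) / pi) powr p / \<omega> powr p"
    by (rule powr_divide)
  finally show "v < (sin (pi * \<omega>) / pi) powr p / (\<omega> powr p * (1 / \<omega> + 4 + 1 / \<omega> / (p - 1)))"
    using v by simp
qed

section \<open>The sinc integral and the limit of the constant for large exponents\<close>

lemma has_real_derivative_sin_sinc:
  "((\<lambda>x. sin x * sinc x) has_real_derivative (2 * sinc (2 * x) - (sinc x)\<^sup>2)) (at x)"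
proof (cases "x = 0")
  case True
  have "(\<lambda>h. sinc h * sinc h) \<midarrow>0\<rightarrow> sinc 0 * sinc 0"
    using isCont_sinc[of 0] unfolding isCont_def by (intro tendsto_mult)
  then have "(\<lambda>h. sinc h * sinc h) \<midarrow>0\<rightarrow> 1" by simp
  moreover have "\<forall>\<^sub>F h in at 0. sinc h * sinc h = (sin (0 + h) * sinc (0 + h) - sin 0 * sinc 0) / h"
    by (auto simp: eventually_at_filter)
  ultimately have "(\<lambda>h. (sin (0 + h) * sinc (0 + h) - sin 0 * sinc 0) / h) \<midarrow>0\<rightarrow> 1"
    by (rule Lim_transform_eventually)
  then show ?thesis unfolding True DERIV_def by simp
next
  case False
  have "sin (x * 2) = 2 * (sin x * cos x)" using sin_double[of x] by (simp add: mult.commute)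
  then have "((\<lambda>x. sin x * (sin x / x)) has_real_derivative (2 * sinc (2 * x) - (sinc x)\<^sup>2)) (at x)"
    using False by (auto intro!: derivative_eq_intros simp: power2_eq_square field_simps)
  then show ?thesis
    by (rule has_field_derivative_transform_within_open[of _ _ _ "- {0}"]) (use False in auto)
qed

text \<open>
  Integration by parts reduces the integral of \<open>(sin x / x)\<^sup>2\<close> to the Dirichlet integral: \<open>Si (2 x) - (sin x)\<^sup>2 / x\<close> is an
  antiderivative.
\<close>

lemma nn_integral_sinc_squared:
  "(\<integral>\<^sup>+x. ennreal ((sinc x)\<^sup>2) * indicator {0..} x \<partial>lborel) = ennreal (pi / 2)"
proof -
  let ?F = "\<lambda>x. Si (2 * x) - sin x * sinc x"
  have "(\<integral>\<^sup>+x. ennreal ((sinc x)\<^sup>2) * indicator {0..} x \<partial>lborel) = ennreal (pi / 2 - ?F 0)"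
  proof (rule nn_integral_FTC_atLeast[where f = "\<lambda>x. (sinc x)\<^sup>2" and F = ?F and a = 0 and T = "pi / 2"])
    show "(\<lambda>x. (sinc x)\<^sup>2) \<in> borel_measurable borel" by measurable
    show "(?F has_real_derivative (sinc x)\<^sup>2) (at x)" if "0 \<le> x" for x
    proof -
      have "((\<lambda>x. Si (2 * x)) has_real_derivative sinc (2 * x) * 2) (at x)"
        by (rule DERIV_chain'[where f = "\<lambda>x. 2 * x", OF _ DERIV_Si]) (auto intro!: derivative_eq_intros)
      from DERIV_diff[OF this has_real_derivative_sin_sinc[of x]] show ?thesis by simp
    qed
    have "((\<lambda>x. Si (2 * x)) \<longlongrightarrow> pi / 2) at_top"
      by (rule filterlim_compose[OF Si_at_top])
        (intro filterlim_tendsto_pos_mult_at_top[OF tendsto_const] filterlim_ident; simp)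
    moreover have "((\<lambda>x. sin x * sinc x) \<longlongrightarrow> 0) at_top"
    proof (rule Lim_null_comparison)
      show "\<forall>\<^sub>F x in at_top. norm (sin x * sinc x) \<le> 1 / x"
        using eventually_gt_at_top[of 0]
      proof eventually_elim
        case (elim x)
        have "\<bar>sin x\<bar> * \<bar>sin x\<bar> \<le> 1 * 1" by (intro mult_mono) auto
        then show ?case using elim by (simp add: abs_mult divide_right_mono)
      qed
      show "((\<lambda>x::real. 1 / x) \<longlongrightarrow> 0) at_top"
        by (rule tendsto_divide_0[OF tendsto_const filterlim_at_top_imp_at_infinity[OF filterlim_ident]])
    qed
    ultimately show "(?F \<longlongrightarrow> pi / 2) at_top"
      using tendsto_diff by fastforce
  qed simp
  also have "?F 0 = 0" by (simp add: Si_def zero_ereal_def)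
  finally show ?thesis by simp
qed

lemma sinc_power_integral:
  fixes p :: real
  assumes "2 \<le> p"
  shows "set_integrable lebesgue {0<..} (\<lambda>x. \<bar>sin x / x\<bar> powr p)"
    and "(LINT x:{0<..}|lebesgue. \<bar>sin x / x\<bar> powr p) \<le> pi / 2"
proof -
  let ?s = "\<lambda>x::real. indicat_real {0..} x * (sinc x)\<^sup>2"
  let ?t = "\<lambda>x::real. indicat_real {0<..} x *\<^sub>R \<bar>sin x / x\<bar> powr p"
  have "has_bochner_integral lborel ?s (pi / 2)"
  proof (rule has_bochner_integral_nn_integral)
    show "(\<integral>\<^sup>+x. ennreal (?s x) \<partial>lborel) = ennreal (pi / 2)"
      unfolding nn_integral_sinc_squared[symmetric]
      by (intro nn_integral_cong) (auto simp: indicator_def)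
  qed auto
  then have s: "integrable lborel ?s" "(LINT x|lborel. ?s x) = pi / 2"
    by (auto simp: has_bochner_integral_iff)
  have le: "?t x \<le> ?s x" for x
  proof (cases "0 < x")
    case True
    have "\<bar>sin x\<bar> \<le> \<bar>x\<bar>" by (rule abs_sin_x_le_abs_x)
    then have "\<bar>sin x / x\<bar> \<le> 1" using True by simp
    then have "\<bar>sin x / x\<bar> powr p \<le> \<bar>sin x / x\<bar> powr 2" using assms by (intro powr_mono') auto
    then show ?thesis using True by (cases "sin x = 0") (auto simp: power_divide)
  qed auto
  have t: "integrable lborel ?t"
  proof (rule Bochner_Integration.integrable_bound[OF s(1)])
    show "AE x in lborel. norm (?t x) \<le> norm (?s x)" using le by (intro AE_I2) auto
  qed measurable
  show "set_integrable lebesgue {0<..} (\<lambda>x. \<bar>sin x / x\<bar> powr p)"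
    unfolding set_integrable_def using t by (rule integrable_completion[THEN iffD2, rotated]) auto
  have "(LINT x:{0<..}|lebesgue. \<bar>sin x / x\<bar> powr p) = (LINT x|lborel. ?t x)"
    unfolding set_lebesgue_integral_def using t by (intro integral_completion) auto
  also have "\<dots> \<le> (LINT x|lborel. ?s x)" using t s le by (intro integral_mono)
  finally show "(LINT x:{0<..}|lebesgue. \<bar>sin x / x\<bar> powr p) \<le> pi / 2" using s by simp
qed

lemma cos_times_le_sin:
  assumes "0 \<le> x" "x \<le> a" "a \<le> pi"
  shows "x * cos a \<le> sin x"
proof (cases "x = 0")
  case False
  have "\<exists>z. 0 < z \<and> z < x \<and> sin x - sin 0 = (x - 0) * cos z"
    by (rule MVT2) (use assms False in \<open>auto intro!: derivative_eq_intros\<close>)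
  then obtain z where z: "0 < z" "z < x" "sin x = x * cos z" by auto
  have "cos a \<le> cos z" using z assms by (intro cos_monotone_0_pi_le) auto
  then show ?thesis using z assms by (simp add: mult_left_mono)
qed simp

lemma sinc_power_integral_ge:
  fixes p a :: real
  assumes "2 \<le> p" "0 < a" "a \<le> pi / 2"
  shows "a * cos a powr p \<le> (LINT x:{0<..}|lebesgue. \<bar>sin x / x\<bar> powr p)"
proof -
  have c: "0 \<le> cos a" using assms by (intro cos_ge_zero) auto
  have "a * cos a powr p = (LINT x:{0<..a}|lebesgue. cos a powr p)"
    using assms by (simp add: set_lebesgue_integral_def)
  also have "\<dots> \<le> (LINT x:{0<..}|lebesgue. \<bar>sin x / x\<bar> powr p)"
    unfolding set_lebesgue_integral_def
  proof (rule integral_mono)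
    show "integrable lebesgue (\<lambda>x. indicat_real {0<..a} x *\<^sub>R cos a powr p)"
      using assms by (intro integrable_scaleR_left integrable_real_indicator) (auto simp: emeasure_lborel_Ioc)
    show "integrable lebesgue (\<lambda>x. indicat_real {0<..} x *\<^sub>R \<bar>sin x / x\<bar> powr p)"
      using sinc_power_integral(1)[OF assms(1)] by (simp add: set_integrable_def)
    fix x
    have "cos a powr p \<le> \<bar>sin x / x\<bar> powr p" if "0 < x" "x \<le> a"
    proof (intro powr_mono2)
      have "cos a \<le> sin x / x" using cos_times_le_sin[of x a] that assms by (simp add: field_simps)
      then show "cos a \<le> \<bar>sin x / x\<bar>" by linarith
    qed (use c assms in auto)
    then show "indicat_real {0<..a} x *\<^sub>R cos a powr p \<le> indicat_real {0<..} x *\<^sub>R \<bar>sin x / x\<bar> powr p"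
      by (auto simp: indicator_def)
  qed
  finally show ?thesis .
qed

lemma star_quotient_le_pi:
  fixes p w :: real
  assumes "1 \<le> p" "w \<in> {0..1}"
  shows "sin (pi * w) / w powr (1 - 1 / p) \<le> pi"
proof (cases "w = 0")
  case False
  then have w: "0 < w" "w \<le> 1" using assms by auto
  have "sin (pi * w) \<le> pi * w" using w by (intro sin_x_le_x) auto
  also have "\<dots> \<le> pi * w powr (1 - 1 / p)"
    using powr_mono'[of "1 - 1 / p" 1 w] w assms by auto
  finally show ?thesis using w by (simp add: field_simps)
qed simp

lemma bdd_above_star:
  "1 \<le> p \<Longrightarrow> bdd_above ((\<lambda>\<omega>. sin (pi * \<omega>) / \<omega> powr (1 - 1 / p)) ` {0..1::real})"
  using star_quotient_le_pi by (intro bdd_aboveI2[where M = pi]) auto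

lemma star_SUP_nonneg:
  assumes "1 \<le> p"
  shows "0 \<le> (SUP \<omega> \<in> {0..1::real}. sin (pi * \<omega>) / \<omega> powr (1 - 1 / p))"
  by (rule cSUP_upper2[OF bdd_above_star[OF assms], of 0]) auto

text \<open>
  For \<open>p \<ge> 2\<close> the integral is at most its value \<open>\<pi> / 2\<close> at \<open>p = 2\<close>, so the factor in front of the supremum is at
  most \<open>1 / \<pi>\<close>.
\<close>

lemma star_factor_le:
  assumes "2 \<le> p"
  shows "(2 / pi powr (p + 1) * (LINT x:{0<..}|lebesgue. \<bar>sin x / x\<bar> powr p)) powr (1 / p) \<le> 1 / pi"
proof -
  have I: "0 \<le> (LINT x:{0<..}|lebesgue. \<bar>sin x / x\<bar> powr p)"
    unfolding set_lebesgue_integral_def by (intro integral_nonneg_AE) auto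
  have "2 / pi powr (p + 1) * (LINT x:{0<..}|lebesgue. \<bar>sin x / x\<bar> powr p) \<le> 2 / pi powr (p + 1) * (pi / 2)"
    using sinc_power_integral(2)[OF assms] by (intro mult_left_mono) auto
  also have "\<dots> = (1 / pi) powr p" by (simp add: powr_add powr_divide)
  finally have "(2 / pi powr (p + 1) * (LINT x:{0<..}|lebesgue. \<bar>sin x / x\<bar> powr p)) powr (1 / p)
      \<le> ((1 / pi) powr p) powr (1 / p)"
    using assms I by (intro powr_mono2) auto
  also have "\<dots> = 1 / pi" using assms by (simp add: powr_powr)
  finally show ?thesis .
qed

lemma c_star_nonneg: "2 \<le> p \<Longrightarrow> 0 \<le> c_star p"
  unfolding c_star_def using star_SUP_nonneg[of p] by (intro mult_nonneg_nonneg) auto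

lemma c_star_le:
  assumes "2 \<le> p"
  shows "c_star p \<le> (SUP \<omega> \<in> {0..1}. sin (pi * \<omega>) / \<omega> powr (1 - 1 / p)) / pi"
  unfolding c_star_def using mult_right_mono[OF star_factor_le[OF assms] star_SUP_nonneg[of p]] assms by simp

lemma c_star_le_1:
  assumes "2 \<le> p"
  shows "c_star p \<le> 1"
proof -
  have "(SUP \<omega> \<in> {0..1}. sin (pi * \<omega>) / \<omega> powr (1 - 1 / p)) \<le> pi"
    using assms star_quotient_le_pi[of p] by (intro cSUP_least) auto
  then have "(SUP \<omega> \<in> {0..1}. sin (pi * \<omega>) / \<omega> powr (1 - 1 / p)) / pi \<le> 1" by simp
  then show ?thesis using c_star_le[OF assms] by linarith
qed

text \<open>
  Only the interval \<open>(0, a]\<close> of the integral and the single point \<open>\<omega> = a / \<pi>\<close> of the supremum are kept. As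
  \<open>p\<close> tends to infinity the left-hand side tends to \<open>cos a * (sin a / a)\<close>, which is close to 1 for small \<open>a\<close>.
\<close>

lemma c_star_ge:
  fixes p a :: real
  assumes "2 \<le> p" "0 < a" "a \<le> pi / 2"
  shows "(2 * a / pi) powr (1 / p) * (cos a / pi) * (sin a / (a / pi) powr (1 - 1 / p)) \<le> c_star p"
proof -
  have c: "0 \<le> cos a" using assms by (intro cos_ge_zero) auto
  have s: "0 \<le> sin a" using assms by (intro sin_ge_zero) auto
  have "(2 * a / pi) powr (1 / p) * (cos a / pi) = (2 * a / pi) powr (1 / p) * ((cos a / pi) powr p) powr (1 / p)"
    using c assms by (simp add: powr_powr)
  also have "\<dots> = (2 * a / pi * (cos a / pi) powr p) powr (1 / p)"
    by (rule powr_mult[symmetric])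
  also have "2 * a / pi * (cos a / pi) powr p = 2 / pi powr (p + 1) * (a * cos a powr p)"
    by (simp add: powr_add powr_divide mult_ac)
  also have "(2 / pi powr (p + 1) * (a * cos a powr p)) powr (1 / p)
     \<le> (2 / pi powr (p + 1) * (LINT x:{0<..}|lebesgue. \<bar>sin x / x\<bar> powr p)) powr (1 / p)"
    using assms by (intro powr_mono2 mult_left_mono sinc_power_integral_ge) auto
  finally have 1: "(2 * a / pi) powr (1 / p) * (cos a / pi)
     \<le> (2 / pi powr (p + 1) * (LINT x:{0<..}|lebesgue. \<bar>sin x / x\<bar> powr p)) powr (1 / p)" .
  have "sin (pi * (a / pi)) / (a / pi) powr (1 - 1 / p) \<le> (SUP \<omega> \<in> {0..1}. sin (pi * \<omega>) / \<omega> powr (1 - 1 / p))"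
    using assms by (intro cSUP_upper bdd_above_star) (auto simp: field_simps)
  then have 2: "sin a / (a / pi) powr (1 - 1 / p) \<le> (SUP \<omega> \<in> {0..1}. sin (pi * \<omega>) / \<omega> powr (1 - 1 / p))"
    by simp
  show ?thesis unfolding c_star_def using 1 2 c s by (intro mult_mono) auto
qed

lemma c_star_tendsto: "(c_star \<longlongrightarrow> 1) at_top"
proof (rule order_tendstoI)
  fix y :: real assume "1 < y"
  show "\<forall>\<^sub>F p in at_top. c_star p < y"
    using eventually_ge_at_top[of 2]
  proof eventually_elim
    case (elim p)
    then show ?case using c_star_le_1[of p] \<open>1 < y\<close> by linarith
  qed
next
  fix y :: real assume y: "y < 1"
  have "((\<lambda>a::real. cos a * (sin a / a)) \<longlongrightarrow> cos 0 * 1) (at_right 0)"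
  proof (rule tendsto_mult)
    show "((\<lambda>a. cos a) \<longlongrightarrow> cos 0) (at_right (0::real))" by (intro tendsto_cos tendsto_ident_at)
    show "((\<lambda>a::real. sin a / a) \<longlongrightarrow> 1) (at_right 0)" by (rule tendsto_mono[OF at_le sinc_at_0]) simp
  qed
  then have "\<forall>\<^sub>F a in at_right 0. y < cos a * (sin a / a)"
    by (rule order_tendstoD(1)) (use y in simp)
  moreover have "\<forall>\<^sub>F a in at_right 0. 0 < a \<and> a < pi / 2"
    using eventually_at_right_real[of 0 "pi / 2"] by simp
  ultimately have "\<forall>\<^sub>F a in at_right 0. y < cos a * (sin a / a) \<and> 0 < a \<and> a < pi / 2"
    by eventually_elim simp
  then obtain a where a: "y < cos a * (sin a / a)" "0 < a" "a < pi / 2"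
    using eventually_happens'[of "at_right (0::real)"] trivial_limit_at_right_real by blast
  have inv: "((\<lambda>p::real. 1 / p) \<longlongrightarrow> 0) at_top"
    by (rule tendsto_divide_0[OF tendsto_const filterlim_at_top_imp_at_infinity[OF filterlim_ident]])
  have "((\<lambda>p. (2 * a / pi) powr (1 / p) * (cos a / pi) * (sin a / (a / pi) powr (1 - 1 / p)))
     \<longlongrightarrow> (2 * a / pi) powr 0 * (cos a / pi) * (sin a / (a / pi) powr (1 - 0))) at_top"
    using a by (intro tendsto_intros inv) auto
  also have "(2 * a / pi) powr 0 * (cos a / pi) * (sin a / (a / pi) powr (1 - 0)) = cos a * (sin a / a)"
    using a by simp
  finally have "\<forall>\<^sub>F p in at_top. y < (2 * a / pi) powr (1 / p) * (cos a / pi) * (sin a / (a / pi) powr (1 - 1 / p))"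
    using a(1) by (rule order_tendstoD(1))
  then show "\<forall>\<^sub>F p in at_top. y < c_star p"
    using eventually_ge_at_top[of 2]
  proof eventually_elim
    case (elim p)
    then show ?case using c_star_ge[of p a] a by linarith
  qed
qed

section \<open>Concentration at the levels of the two constants\<close>

lemma idempotent_polys_nonempty: "idempotent_polys \<noteq> {}"
  unfolding idempotent_polys_def by (auto intro!: exI[of _ "{0}"])

lemma continuous_on_idempotent_poly: "f \<in> idempotent_polys \<Longrightarrow> continuous_on A f"
  unfolding idempotent_polys_def by (auto intro!: continuous_intros)

lemma Lp_ratio_nonneg: "0 \<le> Lp_ratio p E f"
  unfolding Lp_ratio_def set_lebesgue_integral_def
  by (intro divide_nonneg_nonneg integral_nonneg_AE) auto

lemma Lp_ratio_le_1:
  assumes "0 < p" "f \<in> idempotent_polys" "E \<in> sets lebesgue" "E \<subseteq> circle"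
  shows "Lp_ratio p E f \<le> 1"
proof -
  let ?g = "\<lambda>x. norm (f x) powr p"
  have int: "set_integrable lebesgue S ?g" if "S \<in> sets lebesgue" "S \<subseteq> circle" for S
  proof (rule set_integrable_subset)
    show "set_integrable lebesgue {0..1} ?g"
      using assms by (intro absolutely_integrable_continuous_real continuous_on_norm_powr continuous_on_idempotent_poly)
  qed (use that in \<open>auto simp: circle_def\<close>)
  have "(LINT x:E|lebesgue. ?g x) \<le> (LINT x:circle|lebesgue. ?g x)"
    unfolding set_lebesgue_integral_def
  proof (rule integral_mono)
    show "integrable lebesgue (\<lambda>x. indicat_real E x *\<^sub>R ?g x)"
      using int assms by (simp add: set_integrable_def)
    have "circle \<in> sets lebesgue" by (simp add: circle_def)
    then show "integrable lebesgue (\<lambda>x. indicat_real circle x *\<^sub>R ?g x)"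
      using int[of circle] by (simp add: set_integrable_def)
  qed (use assms in \<open>auto simp: indicator_def\<close>)
  moreover have "0 \<le> (LINT x:circle|lebesgue. ?g x)"
    unfolding set_lebesgue_integral_def by (intro integral_nonneg_AE) auto
  ultimately show ?thesis unfolding Lp_ratio_def by (simp add: divide_le_eq_1) (auto simp: order_le_less)
qed

lemma less_powr_inverse:
  fixes p x y :: real
  assumes "0 < p" "0 \<le> y" "y powr p < x"
  shows "y < x powr (1 / p)"
proof -
  have "(y powr p) powr (1 / p) < x powr (1 / p)"
    using assms by (intro powr_less_mono2) auto
  then show ?thesis using assms by (simp add: powr_powr)
qed

lemma concentration_c_star:
  assumes p: "2 \<le> p" and E: "E \<in> sets lebesgue" "E \<subseteq> circle" "measure lebesgue E > 0"
    and y: "y < c_star p"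
  shows "\<exists>f\<in>idempotent_polys. y < Lp_ratio p E f powr (1 / p)"
proof (cases "0 \<le> y")
  case False
  then show ?thesis using idempotent_polys_nonempty
    by (metis all_not_in_conv less_le_trans not_le powr_ge_zero)
next
  case True
  have "y * pi < (SUP \<omega> \<in> {0..1}. sin (pi * \<omega>) / \<omega> powr (1 - 1 / p))"
    using y c_star_le[OF p] by (simp add: less_le_trans flip: pos_less_divide_eq)
  then obtain w where w: "w \<in> {0..1}" "y * pi < sin (pi * w) / w powr (1 - 1 / p)"
    using less_cSupD[of "(\<lambda>\<omega>. sin (pi * \<omega>) / \<omega> powr (1 - 1 / p)) ` {0..1}" "y * pi"] by auto
  have yp: "0 \<le> y * pi" using True by simp
  have "w \<noteq> 0" "w \<noteq> 1" using w yp by (auto intro!: notI)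
  then have w01: "0 < w" "w < 1" using w by auto
  define B where "B = sin (pi * w) / pi / w powr (1 - 1 / p)"
  have "y < sin (pi * w) / w powr (1 - 1 / p) / pi"
    using w(2) by (simp only: pos_less_divide_eq[OF pi_gt_zero])
  also have "\<dots> = B" by (simp add: B_def mult.commute)
  finally have yB: "y < B" .
  have "B powr p = (sin (pi * w) / pi) powr p / (w powr (1 - 1 / p)) powr p"
    unfolding B_def by (rule powr_divide)
  also have "(w powr (1 - 1 / p)) powr p = w powr (p - 1)"
    using p by (simp add: powr_powr left_diff_distrib)
  finally have "y powr p < (sin (pi * w) / pi) powr p / w powr (p - 1)"
    using powr_less_mono2[of p y B] p True yB by simp
  from concentration_ge_2[OF p w01 E this] show ?thesis
    using less_powr_inverse[of p y] p True by fastforce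
qed

text \<open>
  The explicit constant is weaker than what the moment bound gives. After \<open>1 / \<omega> \<le> \<lfloor>1 / \<omega>\<rfloor> + 1\<close>, the terms with
  \<open>1 / (p - 1)\<close> are compared through \<open>2\<^sup>p\<^sup>+\<^sup>1 (3/8)\<^sup>p = 3/2 (3/4)\<^sup>p\<^sup>-\<^sup>1 \<ge> 3/2 - (p - 1) / 2\<close>, and the factor
  \<open>2\<^sup>p\<^sup>+\<^sup>1 \<ge> 4\<close> leaves room for the rest.
\<close>

lemma c_lower_denominator_le:
  fixes p w :: real
  assumes p: "1 < p" "p \<le> 2" and w: "0 < w" "w < 1 / 2"
  shows "1 / w + 4 + 1 / w / (p - 1)
    \<le> 2 powr (p + 1) * (of_int \<lfloor>1 / w\<rfloor> + 1 + 1 / (p - 1) * (3 / 8) powr p * of_int \<lfloor>1 / w\<rfloor>)"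
proof -
  define N :: real where "N = of_int \<lfloor>1 / w\<rfloor>"
  have "2 < 1 / w" using w by (simp add: field_simps)
  then have "2 \<le> \<lfloor>1 / w\<rfloor>" by (simp add: le_floor_iff)
  then have N: "2 \<le> N" by (simp add: N_def)
  have wN: "1 / w \<le> N + 1" unfolding N_def by (rule real_of_int_floor_add_one_ge)
  define t where "t = p - 1"
  have t: "0 < t" using p by (simp add: t_def)
  have ln: "- (1 / 3) \<le> ln (3 / 4 :: real)"
    using ln_le_minus_one[of "4 / 3 :: real"] by (simp add: ln_div)
  have "1 - t / 3 \<le> 1 + t * ln (3 / 4)"
    using mult_left_mono[OF ln, of t] t by simp
  also have "\<dots> \<le> (3 / 4) powr t"
    unfolding powr_def using exp_ge_add_one_self by simp
  finally have e: "1 - t / 3 \<le> (3 / 4) powr t" .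
  have "2 powr (p + 1) * (3 / 8) powr p = 2 * ((2 * (3 / 8)) powr p)"
    by (simp only: powr_mult powr_add) simp
  also have "\<dots> = 3 / 2 * (3 / 4) powr t"
    by (simp add: t_def powr_diff)
  finally have e2: "3 / 2 - t / 2 \<le> 2 powr (p + 1) * (3 / 8) powr p" using e by simp
  have f: "4 \<le> (2::real) powr (p + 1)"
    using powr_mono[of 2 "p + 1" "2::real"] p by simp
  have "1 / w + 4 + 1 / w / (p - 1) \<le> N + 1 + 4 + (N + 1) / t"
    unfolding t_def using N wN p by (intro add_mono divide_right_mono) auto
  also have "\<dots> \<le> 4 * (N + 1) + (3 / 2 - t / 2) * N / t"
  proof -
    have "(N + 1) / t \<le> 3 / 2 * N / t" using N t by (intro divide_right_mono) auto
    moreover have eq: "(3 / 2 - t / 2) * N / t = 3 / 2 * N / t - N / 2"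
      using t by (simp add: field_simps)
    moreover have "N + 1 + 4 + u \<le> 4 * (N + 1) + (v - N / 2)" if "u \<le> v" for u v :: real
      using that N by simp
    ultimately show ?thesis unfolding eq by blast
  qed
  also have "\<dots> \<le> 2 powr (p + 1) * (N + 1) + (2 powr (p + 1) * (3 / 8) powr p) * N / t"
    using e2 f N t by (intro add_mono mult_right_mono divide_right_mono) auto
  also have "\<dots> = 2 powr (p + 1) * (N + 1 + 1 / (p - 1) * (3 / 8) powr p * N)"
    by (simp add: t_def distrib_left)
  finally show ?thesis unfolding N_def .
qed

lemma concentration_c_lower_at:
  fixes p w y :: real
  assumes p: "1 < p" "p \<le> 2" and w: "0 < w" "w < 1 / 2"
    and E: "E \<in> sets lebesgue" "E \<subseteq> circle" "measure lebesgue E > 0"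
    and y: "y < (sin (pi * w) / (pi * w)) /
        (2 powr (1 + 1 / p) *
         (of_int \<lfloor>1 / w\<rfloor> + 1 + 1 / (p - 1) * (3 / 8) powr p * of_int \<lfloor>1 / w\<rfloor>) powr (1 / p))"
  shows "\<exists>f\<in>idempotent_polys. y < Lp_ratio p E f powr (1 / p)"
proof (cases "0 \<le> y")
  case False
  then show ?thesis using idempotent_polys_nonempty
    by (metis all_not_in_conv less_le_trans not_le powr_ge_zero)
next
  case True
  define M :: real where "M = of_int \<lfloor>1 / w\<rfloor> + 1 + 1 / (p - 1) * (3 / 8) powr p * of_int \<lfloor>1 / w\<rfloor>"
  define G where "G = sin (pi * w) / (pi * w)"
  have fl: "0 \<le> (of_int \<lfloor>1 / w\<rfloor> :: real)" using w by simp
  have M: "0 < M" unfolding M_def using fl p by (intro add_nonneg_pos add_pos_nonneg mult_nonneg_nonneg) auto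
  have G: "0 < G" unfolding G_def using w by (intro divide_pos_pos sin_gt_zero mult_pos_pos) auto
  have yG: "y < G / (2 powr (1 + 1 / p) * M powr (1 / p))" using y unfolding M_def G_def .
  have "y powr p < (G / (2 powr (1 + 1 / p) * M powr (1 / p))) powr p"
    using yG True p by (intro powr_less_mono2) auto
  also have "\<dots> = G powr p / ((2 powr (1 + 1 / p)) powr p * (M powr (1 / p)) powr p)"
    by (simp only: powr_divide powr_mult)
  also have "\<dots> = G powr p / (2 powr (p + 1) * M)"
    using p M by (simp add: powr_powr distrib_right)
  also have "\<dots> \<le> G powr p / (1 / w + 4 + 1 / w / (p - 1))"
    using c_lower_denominator_le[OF p w] w p M unfolding M_def[symmetric]
    by (intro divide_left_mono mult_pos_pos add_pos_pos) auto
  finally have "y powr p < (sin (pi * w) / (pi * w)) powr p / (1 / w + 4 + 1 / w / (p - 1))"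
    unfolding G_def .
  from concentration_gt_1[OF p(1) w(1) _ E this] w show ?thesis
    using less_powr_inverse[of p y] p True by fastforce
qed

lemma concentration_c_lower:
  assumes p: "1 < p" "p \<le> 2" and E: "E \<in> sets lebesgue" "E \<subseteq> circle" "measure lebesgue E > 0"
    and y: "y < c_lower p"
  shows "\<exists>f\<in>idempotent_polys. y < Lp_ratio p E f powr (1 / p)"
proof -
  obtain w where w: "w \<in> {0<..<1 / 2}" "y < (sin (pi * w) / (pi * w)) /
        (2 powr (1 + 1 / p) *
         (of_int \<lfloor>1 / w\<rfloor> + 1 + 1 / (p - 1) * (3 / 8) powr p * of_int \<lfloor>1 / w\<rfloor>) powr (1 / p))"
    using less_cSupD[OF _ y[unfolded c_lower_def]] by auto
  show ?thesis using concentration_c_lower_at[OF p _ _ E w(2)] w(1) by simp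
qed

lemma circle_measure: "circle \<in> sets lebesgue" "measure lebesgue circle > 0"
  by (simp_all add: circle_def)

text \<open>
  Nonnegativity needs the family defining the constant to be bounded above; this follows from the concentration
  statement on the whole circle, where the ratio is at most 1.
\<close>

lemma c_lower_nonneg:
  assumes p: "1 < p" "p \<le> 2"
  shows "0 \<le> c_lower p"
proof -
  let ?F = "\<lambda>w. (sin (pi * w) / (pi * w)) /
        (2 powr (1 + 1 / p) *
         (of_int \<lfloor>1 / w\<rfloor> + 1 + 1 / (p - 1) * (3 / 8) powr p * of_int \<lfloor>1 / w\<rfloor>) powr (1 / p)) :: real"
  have "?F w \<le> 1" if w: "w \<in> {0<..<1 / 2}" for w
  proof (rule dense_le)
    fix y assume "y < ?F w"
    then obtain f where "f \<in> idempotent_polys" "y < Lp_ratio p circle f powr (1 / p)"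
      using concentration_c_lower_at[OF p _ _ circle_measure(1) subset_refl circle_measure(2)] w by auto
    then show "y \<le> 1"
      using powr_le1[of "1 / p" "Lp_ratio p circle f"] Lp_ratio_le_1[of p f circle] Lp_ratio_nonneg[of p circle f]
        circle_measure p by auto
  qed
  then have "bdd_above (?F ` {0<..<1 / 2})" by (intro bdd_aboveI2)
  then have "?F (1 / 4) \<le> c_lower p"
    unfolding c_lower_def by (intro cSUP_upper) auto
  moreover have "0 \<le> ?F (1 / 4)"
    by (intro divide_nonneg_nonneg mult_nonneg_nonneg sin_ge_zero) auto
  ultimately show ?thesis by linarith
qed

section \<open>Bounds for the concentration constant\<close>

lemma le_conc_const:
  assumes p: "1 < p"
    and c: "\<And>E y. E \<in> sets lebesgue \<Longrightarrow> E \<subseteq> circle \<Longrightarrow> measure lebesgue E > 0 \<Longrightarrow> y < c \<Longrightarrow>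
      \<exists>f\<in>idempotent_polys. y < Lp_ratio p E f powr (1 / p)"
  shows "c \<le> conc_const p"
  unfolding conc_const_def
proof (rule cINF_greatest)
  show "{E \<in> sets lebesgue. E \<subseteq> circle \<and> measure lebesgue E > 0} \<noteq> {}"
    using circle_measure by blast
  fix E :: "real set" assume E: "E \<in> {E \<in> sets lebesgue. E \<subseteq> circle \<and> measure lebesgue E > 0}"
  show "c \<le> (SUP f \<in> idempotent_polys. Lp_ratio p E f powr (1 / p))"
  proof (rule dense_le)
    fix y assume "y < c"
    then obtain f where f: "f \<in> idempotent_polys" "y < Lp_ratio p E f powr (1 / p)"
      using c E by blast
    have "bdd_above ((\<lambda>f. Lp_ratio p E f powr (1 / p)) ` idempotent_polys)"
      using E p Lp_ratio_le_1[of p _ E] Lp_ratio_nonneg[of p E]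
      by (intro bdd_aboveI2[where M = 1] powr_le1) auto
    then show "y \<le> (SUP f \<in> idempotent_polys. Lp_ratio p E f powr (1 / p))"
      using f by (intro cSUP_upper2[of _ _ f]) auto
  qed
qed

lemma conc_const_le_1:
  assumes "1 < p"
  shows "conc_const p \<le> 1"
proof -
  have bdd: "bdd_above ((\<lambda>f. Lp_ratio p E f powr (1 / p)) ` idempotent_polys)"
    if "E \<in> sets lebesgue" "E \<subseteq> circle" for E
    using that assms Lp_ratio_le_1[of p _ E] Lp_ratio_nonneg[of p E]
    by (intro bdd_aboveI2[where M = 1] powr_le1) auto
  obtain f where f: "f \<in> idempotent_polys" using idempotent_polys_nonempty by blast
  have "(SUP f \<in> idempotent_polys. Lp_ratio p circle f powr (1 / p)) \<le> 1"
    using circle_measure assms Lp_ratio_le_1[of p _ circle] Lp_ratio_nonneg[of p circle]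
    by (intro cSUP_least idempotent_polys_nonempty powr_le1) auto
  moreover have "conc_const p \<le> (SUP f \<in> idempotent_polys. Lp_ratio p circle f powr (1 / p))"
    unfolding conc_const_def
  proof (rule cINF_lower)
    show "bdd_below ((\<lambda>E. SUP f \<in> idempotent_polys. Lp_ratio p E f powr (1 / p)) `
        {E \<in> sets lebesgue. E \<subseteq> circle \<and> measure lebesgue E > 0})"
      using bdd f by (intro bdd_belowI2[where m = 0]) (auto intro!: cSUP_upper2[of _ _ f])
  qed (use circle_measure in auto)
  ultimately show ?thesis by linarith
qed

lemma exists_integer_spectrum:
  fixes p \<epsilon> c :: real
  assumes p: "1 < p" and \<epsilon>: "0 < \<epsilon>" and c: "0 \<le> c"
    and f: "\<And>y. y < c \<Longrightarrow> \<exists>f\<in>idempotent_polys. y < Lp_ratio p E f powr (1 / p)"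
  shows "\<exists>S::int set. finite S \<and> S \<noteq> {} \<and>
    Lp_ratio p E (\<lambda>x. \<Sum>n\<in>S. unit_exp (of_int n * x)) \<ge> c powr p - \<epsilon>"
proof -
  have "\<exists>f\<in>idempotent_polys. c powr p - \<epsilon> \<le> Lp_ratio p E f"
  proof (cases "c powr p - \<epsilon> \<le> 0")
    case True
    then show ?thesis using idempotent_polys_nonempty Lp_ratio_nonneg[of p E]
      by (meson all_not_in_conv order_trans)
  next
    case False
    define y where "y = (c powr p - \<epsilon>) powr (1 / p)"
    have y: "y powr p = c powr p - \<epsilon>" using False p by (simp add: y_def powr_powr)
    have "y < c"
    proof (rule ccontr)
      assume "\<not> y < c"
      then have "c powr p \<le> y powr p" using c p by (intro powr_mono2) auto
      then show False using y \<epsilon> by simp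
    qed
    then obtain g where g: "g \<in> idempotent_polys" "y < Lp_ratio p E g powr (1 / p)"
      using f by blast
    have "y powr p \<le> (Lp_ratio p E g powr (1 / p)) powr p"
      using g p by (intro powr_mono2) (auto simp: y_def)
    also have "\<dots> = Lp_ratio p E g"
      using p Lp_ratio_nonneg[of p E g] by (simp add: powr_powr)
    finally show ?thesis using g y by auto
  qed
  then obtain S :: "nat set" where S: "finite S" "S \<noteq> {}"
    "c powr p - \<epsilon> \<le> Lp_ratio p E (\<lambda>x. \<Sum>n\<in>S. unit_exp (real n * x))"
    unfolding idempotent_polys_def by blast
  have "(\<lambda>x. \<Sum>n\<in>int ` S. unit_exp (of_int n * x)) = (\<lambda>x. \<Sum>n\<in>S. unit_exp (real n * x))"
    by (simp add: sum.reindex)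
  then show ?thesis using S by (intro exI[of _ "int ` S"]) simp
qed

theorem theorem1:
  shows "(\<forall>p::real. 1 < p \<longrightarrow>
            (p \<le> 2 \<longrightarrow> conc_const p \<ge> c_lower p) \<and>
            (2 \<le> p \<longrightarrow> conc_const p \<ge> c_star p)) \<and>
         (\<forall>(p::real) (\<epsilon>::real) (E::real set).
            1 < p \<longrightarrow> \<epsilon> > 0 \<longrightarrow> E \<in> sets lebesgue \<longrightarrow> E \<subseteq> circle \<longrightarrow> measure lebesgue E > 0 \<longrightarrow>
            (\<exists>S::int set. finite S \<and> S \<noteq> {} \<and>
               (p \<le> 2 \<longrightarrow>
                  Lp_ratio p E (\<lambda>x. \<Sum>n\<in>S. unit_exp (of_int n * x)) \<ge> c_lower p powr p - \<epsilon>) \<and>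
               (2 \<le> p \<longrightarrow>
                  Lp_ratio p E (\<lambda>x. \<Sum>n\<in>S. unit_exp (of_int n * x)) \<ge> c_star p powr p - \<epsilon>))) \<and>
         (c_star \<longlongrightarrow> 1) at_top \<and>
         (conc_const \<longlongrightarrow> 1) at_top"
proof (intro conjI allI impI)
  show lower: "c_lower p \<le> conc_const p" if "1 < p" "p \<le> 2" for p
    using that by (intro le_conc_const concentration_c_lower)
  show star: "c_star p \<le> conc_const p" if "1 < p" "2 \<le> p" for p
    using that by (intro le_conc_const concentration_c_star)
  show "(c_star \<longlongrightarrow> 1) at_top" by (rule c_star_tendsto)
  show "(conc_const \<longlongrightarrow> 1) at_top"
  proof (rule tendsto_sandwich[OF _ _ c_star_tendsto tendsto_const])
    show "\<forall>\<^sub>F p in at_top. c_star p \<le> conc_const p"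
      using eventually_ge_at_top[of 2] by eventually_elim (intro star; simp)
    show "\<forall>\<^sub>F p in at_top. conc_const p \<le> 1"
      using eventually_ge_at_top[of 2] by eventually_elim (intro conc_const_le_1; simp)
  qed
next
  fix p \<epsilon> :: real and E :: "real set"
  assume p: "1 < p" and \<epsilon>: "\<epsilon> > 0" and E: "E \<in> sets lebesgue" "E \<subseteq> circle" "measure lebesgue E > 0"
  \<comment> \<open>At \<open>p = 2\<close> one set has to serve both constants, so the larger one is taken.\<close>
  define c where "c = (if p < 2 then c_lower p else if 2 < p then c_star p else max (c_lower p) (c_star p))"
  have c0: "0 \<le> c"
    using c_lower_nonneg[of p] c_star_nonneg[of p] p by (auto simp: c_def)
  have f: "\<exists>f\<in>idempotent_polys. y < Lp_ratio p E f powr (1 / p)" if "y < c" for y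
    using that concentration_c_lower[OF p _ E, of y] concentration_c_star[OF _ E, of p y]
    by (auto simp: c_def max_def split: if_splits)
  obtain S :: "int set" where S: "finite S" "S \<noteq> {}"
    "c powr p - \<epsilon> \<le> Lp_ratio p E (\<lambda>x. \<Sum>n\<in>S. unit_exp (of_int n * x))"
    using exists_integer_spectrum[OF p \<epsilon> c0 f] by blast
  have "c_lower p powr p \<le> c powr p" if "p \<le> 2"
    using that p c_lower_nonneg[of p] by (intro powr_mono2) (auto simp: c_def)
  moreover have "c_star p powr p \<le> c powr p" if "2 \<le> p"
    using that p c_star_nonneg[of p] by (intro powr_mono2) (auto simp: c_def)
  ultimately show "\<exists>S::int set. finite S \<and> S \<noteq> {} \<and>
      (p \<le> 2 \<longrightarrow> Lp_ratio p E (\<lambda>x. \<Sum>n\<in>S. unit_exp (of_int n * x)) \<ge> c_lower p powr p - \<epsilon>) \<and>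
      (2 \<le> p \<longrightarrow> Lp_ratio p E (\<lambda>x. \<Sum>n\<in>S. unit_exp (of_int n * x)) \<ge> c_star p powr p - \<epsilon>)"
    using S by (intro exI[of _ S]) force
qed

end
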